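(* Let $a,b>0$, $p>6$, and let $h:\mathbb{Z}^3\to\mathbb{R}$ satisfy conditions $(h_1)$ and $(h_2)$ of the context, with $\Omega=\{x\in\mathbb{Z}^3:h(x)=0\}$. Then the equation $$-\left(a+b\int_{\Omega\cup\partial\Omega}|\nabla u|^2\,d\mu\right)\Delta u+u=|u|^{p-2}u\log u^2\ \text{ in }\Omega,\qquad u=0\ \text{ on }\partial\Omega,$$ has a least energy sign-changing solution $u_0\in\mathcal{H}_0^1(\Omega)$, that is, a sign-changing solution satisfying $J_\Omega(u_0)=m_\Omega$. Moreover, $m_\Omega>2c_\Omega$.
   Context: $\mathbb{Z}^3$ is the integer lattice graph: $x\sim y$ iff $\sum_{i=1}^3|x_i-y_i|=1$. $\mu$ is the counting measure, so $\int_Au\,d\mu=\sum_{x\in A}u(x)$. $\Delta u(x)=\sum_{y\sim x}(u(y)-u(x))$, $\nabla u\nabla v(x)=\frac12\sum_{y\sim x}(u(y)-u(x))(v(y)-v(x))$, $|\nabla u|^2=\nabla u\nabla u$. $u^+=\max\{u,0\}$, $u^-=\min\{u,0\}$. Convention: $|t|^{p-2}t\log t^2$ and $|t|^p\log t^2$ are $0$ at $t=0$. Conditions on $h$: $(h_1)$ $h(x)\ge0$ and $\Omega=\{x\in\mathbb{Z}^3:h(x)=0\}$ is a nonempty, connected and bounded domain in $\mathbb{Z}^3$; $(h_2)$ there exists $M>0$ such that $\mu(\{x\in\mathbb{Z}^3:h(x)<M\})<\infty$. The vertex boundary is $\partial\Omega=\{y\in\mathbb{Z}^3\setminus\Omega:\exists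 x\in\Omega,\ x\sim y\}$. $\mathcal{H}_0^1(\Omega)$ is the completion of $C_c(\Omega)$ (functions on $\Omega$ with finite support, extended by $0$ outside $\Omega$) under $\|u\|_{\mathcal{H}_0^1(\Omega)}^2=\int_{\Omega\cup\partial\Omega}a|\nabla u|^2d\mu+\int_\Omega u^2d\mu$. The energy functional $J_\Omega:\mathcal{H}_0^1(\Omega)\to\mathbb{R}$ is $$J_\Omega(u)=\frac12\|u\|_{\mathcal{H}_0^1(\Omega)}^2+\frac b4\left(\int_{\Omega\cup\partial\Omega}|\nabla u|^2d\mu\right)^2+\frac2{p^2}\int_\Omega|u|^pd\mu-\frac1p\int_\Omega|u|^p\log u^2\,d\mu,$$ which is $C^1$ with $$(J_\Omega'(u),\phi)=\int_{\Omega\cup\partial\Omega}a\nabla u\nabla\phi\,d\mu+\int_\Omega u\phi\,d\mu+b\int_{\Omega\cup\partial\Omega}|\nabla u|^2d\mu\int_{\Omega\cup\partial\Omega}\nabla u\nabla\phi\,d\mu-\int_\Omega|u|^{p-2}u\phi\log u^2\,d\mu.$$ A weak solution is $u\in\mathcal{H}_0^1(\Omega)$ with $J_\Omega'(u)=0$; it is a sign-changing solution if moreover $u^+\not\equiv0$ and $u^-\not\equiv0$. $\mathcal{N}_\Omega=\{u\in\mathcal{H}_0^1(\Omega)\setminus\{0\}:(J_\Omega'(u),u)=0\}$, $\mathcal{M}_\Omega=\{u\in\mathcal{H}_0^1(\Omega):u^\pm\ne0,\ (J_\Omega'(u),u^+)=(J_\Omega'(u),u^-)=0\}$, $c_\Omega=\inf_{\mathcal{N}_\Omega}J_\Omega$,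 $m_\Omega=\inf_{\mathcal{M}_\Omega}J_\Omega$.
   Formalization: The formal theorem additionally assumes that Ω has at least two points; if Ω is a single point, conditions (h1) and (h2) can hold but no function in H_0^1(Ω) changes sign, so the claim as stated fails. *)

theory Defs
  imports "HOL-Analysis.Analysis"
begin

type_synonym lattice = "int ^ 3"

definition adj :: "lattice \<Rightarrow> lattice \<Rightarrow> bool" where
  "adj x y \<longleftrightarrow> (\<Sum>i\<in>UNIV. \<bar>x $ i - y $ i\<bar>) = 1"

definition gconnected :: "lattice set \<Rightarrow> bool" where
  "gconnected A \<longleftrightarrow> (\<forall>x\<in>A. \<forall>y\<in>A. (\<lambda>v w. v \<in> A \<and> w \<in> A \<and> adj v w)\<^sup>*\<^sup>* x y)"

text \<open>Bounded in the graph distance: any two points are joined by a walk of length at most \<open>R\<close>.\<close>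

definition gbounded :: "lattice set \<Rightarrow> bool" where
  "gbounded A \<longleftrightarrow> (\<exists>R. \<forall>x\<in>A. \<forall>y\<in>A. \<exists>n\<le>R. (adj ^^ n) x y)"

definition vboundary :: "lattice set \<Rightarrow> lattice set" where
  "vboundary A = {y. y \<notin> A \<and> (\<exists>x\<in>A. adj x y)}"

definition cond_h1 :: "(lattice \<Rightarrow> real) \<Rightarrow> bool" where
  "cond_h1 h \<longleftrightarrow> (\<forall>x. h x \<ge> 0) \<and> {x. h x = 0} \<noteq> {} \<and>
     gconnected {x. h x = 0} \<and> gbounded {x. h x = 0}"

definition cond_h2 :: "(lattice \<Rightarrow> real) \<Rightarrow> bool" where
  "cond_h2 h \<longleftrightarrow> (\<exists>M>0. emeasure (count_space UNIV) {x. h x < M} < \<infinity>)"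

definition grad_prod :: "(lattice \<Rightarrow> real) \<Rightarrow> (lattice \<Rightarrow> real) \<Rightarrow> lattice \<Rightarrow> real" where
  "grad_prod u v x = (1/2) * (\<Sum>y\<in>{y. adj x y}. (u y - u x) * (v y - v x))"

abbreviation grad_sq :: "(lattice \<Rightarrow> real) \<Rightarrow> lattice \<Rightarrow> real" where
  "grad_sq u \<equiv> grad_prod u u"

text \<open>Functions on \<open>\<Omega>\<close> are represented by their extension by zero to the whole lattice.\<close>

definition Cc :: "lattice set \<Rightarrow> (lattice \<Rightarrow> real) set" where
  "Cc \<Omega> = {u. finite {x. u x \<noteq> 0} \<and> {x. u x \<noteq> 0} \<subseteq> \<Omega>}"

definition H01_norm :: "real \<Rightarrow> lattice set \<Rightarrow> (lattice \<Rightarrow> real) \<Rightarrow> real" where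
  "H01_norm a \<Omega> u = sqrt ((LINT x|count_space (\<Omega> \<union> vboundary \<Omega>). a * grad_sq u x)
                        + (LINT x|count_space \<Omega>. (u x)\<^sup>2))"

text \<open>The completion of \<open>Cc \<Omega>\<close>, realised as a space of functions: the norm dominates the
  \<open>\<ell>\<^sup>2\<close> norm on \<open>\<Omega>\<close>, so every Cauchy sequence of \<open>Cc \<Omega>\<close> converges pointwise, and two such
  sequences are equivalent iff their pointwise limits agree.\<close>

definition H01 :: "real \<Rightarrow> lattice set \<Rightarrow> (lattice \<Rightarrow> real) set" where
  "H01 a \<Omega> = {u. \<exists>\<phi>. (\<forall>n. \<phi> n \<in> Cc \<Omega>) \<and>
     (\<forall>e>0. \<exists>N. \<forall>m\<ge>N. \<forall>n\<ge>N. H01_norm a \<Omega> (\<lambda>x. \<phi> m x - \<phi> n x) < e) \<and>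
     (\<forall>x. (\<lambda>n::nat. \<phi> n x) \<longlonglongrightarrow> u x)}"

text \<open>Since \<open>0 powr q = 0\<close>, the terms with \<open>ln\<close> below vanish wherever \<open>u x = 0\<close>.\<close>

definition energy :: "real \<Rightarrow> real \<Rightarrow> real \<Rightarrow> lattice set \<Rightarrow> (lattice \<Rightarrow> real) \<Rightarrow> real" where
  "energy a b p \<Omega> u =
     (1/2) * (H01_norm a \<Omega> u)\<^sup>2
     + (b/4) * (LINT x|count_space (\<Omega> \<union> vboundary \<Omega>). grad_sq u x)\<^sup>2
     + (2/p\<^sup>2) * (LINT x|count_space \<Omega>. \<bar>u x\<bar> powr p)
     - (1/p) * (LINT x|count_space \<Omega>. \<bar>u x\<bar> powr p * ln ((u x)\<^sup>2))"

definition energy_deriv ::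
  "real \<Rightarrow> real \<Rightarrow> real \<Rightarrow> lattice set \<Rightarrow> (lattice \<Rightarrow> real) \<Rightarrow> (lattice \<Rightarrow> real) \<Rightarrow> real" where
  "energy_deriv a b p \<Omega> u \<phi> =
     (LINT x|count_space (\<Omega> \<union> vboundary \<Omega>). a * grad_prod u \<phi> x)
     + (LINT x|count_space \<Omega>. u x * \<phi> x)
     + b * (LINT x|count_space (\<Omega> \<union> vboundary \<Omega>). grad_sq u x)
         * (LINT x|count_space (\<Omega> \<union> vboundary \<Omega>). grad_prod u \<phi> x)
     - (LINT x|count_space \<Omega>. \<bar>u x\<bar> powr (p - 2) * u x * \<phi> x * ln ((u x)\<^sup>2))"

definition pos_part :: "(lattice \<Rightarrow> real) \<Rightarrow> lattice \<Rightarrow> real" where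
  "pos_part u x = max (u x) 0"

text \<open>The negative part is itself nonpositive: \<open>u = pos_part u + neg_part u\<close>.\<close>

definition neg_part :: "(lattice \<Rightarrow> real) \<Rightarrow> lattice \<Rightarrow> real" where
  "neg_part u x = min (u x) 0"

text \<open>Weak formulation of
  \<open>-(a + b \<integral>\<^bsub>\<Omega> \<union> \<partial>\<Omega>\<^esub> |\<nabla>u|\<^sup>2) \<Delta>u + u = |u|\<^bsup>p-2\<^esup> u log u\<^sup>2\<close> in \<open>\<Omega>\<close>, with \<open>u = 0\<close> on \<open>\<partial>\<Omega>\<close>.\<close>

definition weak_solution ::
  "real \<Rightarrow> real \<Rightarrow> real \<Rightarrow> lattice set \<Rightarrow> (lattice \<Rightarrow> real) \<Rightarrow> bool" where
  "weak_solution a b p \<Omega> u \<longleftrightarrow>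
     u \<in> H01 a \<Omega> \<and> (\<forall>\<phi>\<in>H01 a \<Omega>. energy_deriv a b p \<Omega> u \<phi> = 0)"

definition sign_changing_solution ::
  "real \<Rightarrow> real \<Rightarrow> real \<Rightarrow> lattice set \<Rightarrow> (lattice \<Rightarrow> real) \<Rightarrow> bool" where
  "sign_changing_solution a b p \<Omega> u \<longleftrightarrow>
     weak_solution a b p \<Omega> u \<and> pos_part u \<noteq> (\<lambda>x. 0) \<and> neg_part u \<noteq> (\<lambda>x. 0)"

definition Nehari :: "real \<Rightarrow> real \<Rightarrow> real \<Rightarrow> lattice set \<Rightarrow> (lattice \<Rightarrow> real) set" where
  "Nehari a b p \<Omega> = {u \<in> H01 a \<Omega> - {\<lambda>x. 0}. energy_deriv a b p \<Omega> u u = 0}"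

definition nodal_Nehari :: "real \<Rightarrow> real \<Rightarrow> real \<Rightarrow> lattice set \<Rightarrow> (lattice \<Rightarrow> real) set" where
  "nodal_Nehari a b p \<Omega> = {u \<in> H01 a \<Omega>. pos_part u \<noteq> (\<lambda>x. 0) \<and> neg_part u \<noteq> (\<lambda>x. 0) \<and>
     energy_deriv a b p \<Omega> u (pos_part u) = 0 \<and> energy_deriv a b p \<Omega> u (neg_part u) = 0}"

text \<open>Infima are taken in the extended reals, where they need neither nonemptiness nor
  lower bounds to be meaningful.\<close>

definition ground_level :: "real \<Rightarrow> real \<Rightarrow> real \<Rightarrow> lattice set \<Rightarrow> ereal" where
  "ground_level a b p \<Omega> = (INF u\<in>Nehari a b p \<Omega>. ereal (energy a b p \<Omega> u))"

definition nodal_level :: "real \<Rightarrow> real \<Rightarrow> real \<Rightarrow> lattice set \<Rightarrow> ereal" where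
  "nodal_level a b p \<Omega> = (INF u\<in>nodal_Nehari a b p \<Omega>. ereal (energy a b p \<Omega> u))"

text \<open>A one-point domain is connected and bounded but carries no sign-changing function, so
  results on sign-changing solutions have to assume that \<open>\<Omega>\<close> has two distinct points.\<close>

lemma no_sign_changing_solution_singleton:
  "\<not> sign_changing_solution a b p {z} u"
proof
  assume "sign_changing_solution a b p {z} u"
  then have u: "u \<in> H01 a {z}" "pos_part u \<noteq> (\<lambda>x. 0)" "neg_part u \<noteq> (\<lambda>x. 0)"
    by (auto simp: sign_changing_solution_def weak_solution_def)
  have z: "u x = 0" if "x \<noteq> z" for x
  proof -
    from u(1) obtain \<phi> where \<phi>: "\<And>n::nat. \<phi> n \<in> Cc {z}" "(\<lambda>n. \<phi> n x) \<longlonglongrightarrow> u x"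
      unfolding H01_def by blast
    have "\<phi> n x = 0" for n using \<phi>(1)[of n] that by (auto simp: Cc_def)
    with \<phi>(2) show ?thesis by (simp add: LIMSEQ_const_iff)
  qed
  obtain x y where "max (u x) 0 \<noteq> 0" "min (u y) 0 \<noteq> 0"
    using u(2,3) by (auto simp: pos_part_def neg_part_def fun_eq_iff)
  moreover have "x = z" "y = z" using calculation z by force+
  ultimately show False by (auto simp: max_def min_def split: if_splits)
qed

end

(* Condition h2 makes Omega finite, so H01 is the finite-dimensional space of functions supported in
   Omega. For fixed u with both signs, the energy J(s u+ + t u-), written in the coordinates
   (s^p, t^p), is strictly concave: the quadratic and quartic terms have nonnegative coefficients
   and degree at most 4 < p, and the logarithmic term contributes the entropy -X ln X. Hence a point
   of the nodal Nehari set M is the unique maximum of J on its fibre. The set M is closed (its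
   elements take a value >= 1 and a value <= -1, since otherwise the logarithm has the wrong sign)
   and J is coercive on it, so J attains its minimum over M. A minimiser is critical: if J decreased
   along phi, then near the maximum of the fibre every energy would decrease after a small
   perturbation by phi, while the perturbed fibre still has an interior maximum, i.e. meets M.
   Finally s u+ and t u- can be scaled into the Nehari set, and the Kirchhoff term makes J strictly
   superadditive on them: 2c <= J(s u+) + J(t u-) < J(s u+ + t u-) <= J(u). *)

theory Submission
  imports Defs
begin

section \<open>The nonlinearity and its potential\<close>

definition nonlin :: "real \<Rightarrow> real \<Rightarrow> real" where
  "nonlin p t = \<bar>t\<bar> powr (p - 2) * t * ln (t\<^sup>2)"

text \<open>The last two integrands of the energy combined. Its derivative is minus
  \<open>nonlin\<close>; the sign is chosen so that it enters the energy with a plus.\<close>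

definition potential :: "real \<Rightarrow> real \<Rightarrow> real" where
  "potential p t = 2 / p\<^sup>2 * \<bar>t\<bar> powr p - 1 / p * (\<bar>t\<bar> powr p * ln (t\<^sup>2))"

lemma nonlin_zero [simp]: "nonlin p 0 = 0"
  by (simp add: nonlin_def)

lemma potential_zero [simp]: "potential p 0 = 0"
  by (simp add: potential_def)

lemma potential_minus [simp]: "potential p (- t) = potential p t"
  by (simp add: potential_def)

lemma nonlin_minus [simp]: "nonlin p (- t) = - nonlin p t"
  by (simp add: nonlin_def)

lemma powr_eq_powr_mult_square: "\<bar>t\<bar> powr p = \<bar>t\<bar> powr (p - 2) * t\<^sup>2" for t :: real
proof (cases "t = 0")
  case False
  then have "\<bar>t\<bar> powr p = \<bar>t\<bar> powr (p - 2) * \<bar>t\<bar> powr 2"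
    by (simp add: powr_add[symmetric] del: powr_numeral)
  also have "\<bar>t\<bar> powr 2 = t\<^sup>2"
    using False by simp
  finally show ?thesis .
qed simp

lemma nonlin_mult_self: "nonlin p t * t = \<bar>t\<bar> powr p * ln (t\<^sup>2)"
  unfolding powr_eq_powr_mult_square[of t p] by (simp add: nonlin_def power2_eq_square[of t])

text \<open>The logarithm is nonpositive here. This later forces members of the nodal Nehari set to
  take values of modulus at least 1.\<close>

lemma nonlin_mult_self_nonpos: "\<bar>t\<bar> \<le> 1 \<Longrightarrow> nonlin p t * t \<le> 0"
  unfolding nonlin_mult_self
  by (cases "t = 0") (auto intro!: mult_nonneg_nonpos simp: abs_square_le_1)

lemma potential_nonneg: "p > 0 \<Longrightarrow> \<bar>t\<bar> \<le> 1 \<Longrightarrow> potential p t \<ge> 0"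
proof -
  assume "p > 0" "\<bar>t\<bar> \<le> 1"
  then have "1 / p * (\<bar>t\<bar> powr p * ln (t\<^sup>2)) \<le> 0"
    using nonlin_mult_self_nonpos[of t p] by (subst mult_le_0_iff) (simp add: nonlin_mult_self)
  moreover have "2 / p\<^sup>2 * \<bar>t\<bar> powr p \<ge> 0" by simp
  ultimately show ?thesis by (simp only: potential_def)
qed

text \<open>Since p - 2 > 2, the power is at most r^2 on the unit interval, while ln (1/r) \<le> 1/r
  - 1 costs only one factor r. The factor left over controls \<open>nonlin\<close> and
  \<open>potential\<close> near 0.\<close>

lemma powr_mult_ln_bound:
  fixes t p :: real
  assumes "p > 4" "\<bar>t\<bar> \<le> 1"
  shows "\<bar>t\<bar> powr (p - 2) * \<bar>ln (t\<^sup>2)\<bar> \<le> 2 * \<bar>t\<bar>"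
proof (cases "t = 0")
  case False
  define r where "r = \<bar>t\<bar>"
  have r: "0 < r" "r \<le> 1" using False assms by (auto simp: r_def)
  have "r powr (p - 2) \<le> r powr 2"
    using r assms by (intro powr_mono') auto
  then have 1: "r powr (p - 2) \<le> r\<^sup>2" using r by simp
  have "ln (t\<^sup>2) = 2 * ln r" using r ln_realpow[of r 2] by (simp add: r_def)
  moreover have "ln (1 / r) \<le> 1 / r - 1" using r by (intro ln_le_minus_one) simp
  ultimately have 2: "\<bar>ln (t\<^sup>2)\<bar> \<le> 2 / r"
    using r by (simp add: ln_div abs_if)
  have "r powr (p - 2) * \<bar>ln (t\<^sup>2)\<bar> \<le> r\<^sup>2 * (2 / r)"
    using 1 2 r by (intro mult_mono) auto
  also have "\<dots> = 2 * r" using r by (simp add: power2_eq_square)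
  finally show ?thesis by (simp add: r_def)
qed simp

lemma nonlin_bound:
  assumes "p > 4" "\<bar>t\<bar> \<le> 1"
  shows "\<bar>nonlin p t\<bar> \<le> 2 * \<bar>t\<bar>"
proof -
  have "\<bar>nonlin p t\<bar> = (\<bar>t\<bar> powr (p - 2) * \<bar>ln (t\<^sup>2)\<bar>) * \<bar>t\<bar>"
    by (simp add: nonlin_def abs_mult)
  also have "\<dots> \<le> (2 * \<bar>t\<bar>) * 1"
    by (rule mult_mono[OF powr_mult_ln_bound[OF assms]]) (use assms in auto)
  finally show ?thesis by simp
qed

lemma potential_bound:
  assumes "p > 4" "\<bar>t\<bar> \<le> 1"
  shows "\<bar>potential p t\<bar> \<le> 3 * t\<^sup>2"
proof -
  have "\<bar>t\<bar> powr (p - 2) \<le> 1" using assms by (intro powr_le1) auto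
  moreover have "2 / p\<^sup>2 \<le> 1" using assms power_mono[of 4 p 2] by (simp add: field_simps)
  ultimately have 1: "2 / p\<^sup>2 * \<bar>t\<bar> powr (p - 2) \<le> 1" 
    by (intro mult_le_one) auto
  have 2: "\<bar>t\<bar> powr (p - 2) * \<bar>ln (t\<^sup>2)\<bar> \<le> 2"
    using powr_mult_ln_bound[OF assms] assms by linarith
  have 3: "1 / p * (\<bar>t\<bar> powr (p - 2) * \<bar>ln (t\<^sup>2)\<bar>) \<le> 1 * 2"
    using 2 assms by (intro mult_mono) auto
  have "\<bar>potential p t\<bar> = \<bar>2 / p\<^sup>2 * \<bar>t\<bar> powr (p - 2) - 1 / p * (\<bar>t\<bar> powr (p - 2) * ln (t\<^sup>2))\<bar> * t\<^sup>2"
  proof -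
    have "potential p t = (2 / p\<^sup>2 * \<bar>t\<bar> powr (p - 2) - 1 / p * (\<bar>t\<bar> powr (p - 2) * ln (t\<^sup>2))) * t\<^sup>2"
      unfolding potential_def powr_eq_powr_mult_square[of t p] by (simp add: algebra_simps)
    then show ?thesis by (simp add: abs_mult)
  qed
  also have "\<dots> \<le> 3 * t\<^sup>2"
  proof (rule mult_right_mono)
    have "\<bar>1 / p * (\<bar>t\<bar> powr (p - 2) * ln (t\<^sup>2))\<bar> = 1 / p * (\<bar>t\<bar> powr (p - 2) * \<bar>ln (t\<^sup>2)\<bar>)"
      using assms by (simp add: abs_mult)
    moreover have "2 / p\<^sup>2 * \<bar>t\<bar> powr (p - 2) \<ge> 0" by simp
    ultimately show "\<bar>2 / p\<^sup>2 * \<bar>t\<bar> powr (p - 2) - 1 / p * (\<bar>t\<bar> powr (p - 2) * ln (t\<^sup>2))\<bar> \<le> 3"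
      using 1 3 by linarith
  qed simp
  finally show ?thesis .
qed

text \<open>On the positive half-line the absolute value disappears and ln (t^2) = 2 ln t, so the
  formula is elementary; openness of the half-line carries the derivative back to
  \<open>potential\<close>.\<close>

lemma has_derivative_potential_pos:
  assumes "p > 4" "t > 0"
  shows "(potential p has_real_derivative - nonlin p t) (at t)"
proof -
  have "((\<lambda>t. 2 / p\<^sup>2 * t powr p - 1 / p * (t powr p * (2 * ln t))) has_real_derivative - nonlin p t) (at t)"
  proof -
    have "((\<lambda>t. 2 / p\<^sup>2 * t powr p - 1 / p * (t powr p * (2 * ln t))) has_real_derivative
        2 / p\<^sup>2 * (p * t powr (p - 1)) - 1 / p * (t powr p * (2 * (1 / t)) + p * t powr (p - 1) * (2 * ln t))) (at t)"
      using assms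
      by (intro DERIV_diff DERIV_cmult DERIV_mult' has_real_derivative_powr DERIV_ln_divide)
    moreover have "t powr (p - 1) = t powr (p - 2) * t"
      using assms powr_add[of t "p - 2" 1] by simp
    moreover have "t powr p = t powr (p - 2) * t\<^sup>2"
      using powr_eq_powr_mult_square[of t p] assms by simp
    moreover have "ln (t\<^sup>2) = 2 * ln t" using assms by (simp add: ln_realpow)
    ultimately show ?thesis
      using assms by (simp add: nonlin_def field_simps power2_eq_square)
  qed
  then show ?thesis
    by (rule has_field_derivative_transform_within_open[where S = "{0<..}"])
       (use assms in \<open>auto simp: potential_def ln_realpow\<close>)
qed

text \<open>Evenness transfers the case t > 0 to t < 0. At 0 the quadratic bound
  \<open>potential_bound\<close> sends the difference quotient to 0.\<close>

lemma has_derivative_potential: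
  assumes "p > 4"
  shows "(potential p has_real_derivative - nonlin p t) (at t)"
proof -
  consider "t > 0" | "t < 0" | "t = 0" by linarith
  then show ?thesis
  proof cases
    case 1
    then show ?thesis using has_derivative_potential_pos assms by blast
  next
    case 2
    then have "(potential p has_real_derivative - nonlin p (- t)) (at (- t))"
      using has_derivative_potential_pos[OF assms, of "- t"] by simp
    then show ?thesis
      using DERIV_mirror[of "potential p" "nonlin p t" t] by simp
  next
    case 3
    have "((\<lambda>t. potential p t / t) \<longlongrightarrow> 0) (at 0)"
    proof (rule Lim_null_comparison)
      show "\<forall>\<^sub>F t in at 0. norm (potential p t / t) \<le> 3 * \<bar>t\<bar>"
        unfolding eventually_at
      proof (intro exI[of _ 1] conjI ballI impI)
        fix t :: real assume "t \<noteq> 0 \<and> dist t 0 < 1"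
        then have "\<bar>potential p t\<bar> \<le> 3 * \<bar>t\<bar> * \<bar>t\<bar>" "t \<noteq> 0"
          using potential_bound[OF assms, of t] by (auto simp: power2_eq_square)
        then show "norm (potential p t / t) \<le> 3 * \<bar>t\<bar>"
          by (simp add: pos_divide_le_eq)
      qed simp
      show "((\<lambda>t::real. 3 * \<bar>t\<bar>) \<longlongrightarrow> 0) (at 0)"
        by (auto intro!: tendsto_eq_intros)
    qed
    then show ?thesis using 3 by (simp add: has_field_derivative_iff)
  qed
qed

lemma isCont_nonlin:
  assumes "p > 4"
  shows "isCont (nonlin p) t"
proof (cases "t = 0")
  case False
  then show ?thesis unfolding nonlin_def [abs_def] by (auto intro!: continuous_intros)
next
  case True
  have "(nonlin p \<longlongrightarrow> 0) (at 0)"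
  proof (rule Lim_null_comparison)
    show "\<forall>\<^sub>F t in at 0. norm (nonlin p t) \<le> 2 * \<bar>t\<bar>"
      unfolding eventually_at
      by (intro exI[of _ 1]) (auto intro!: nonlin_bound assms)
    show "((\<lambda>t::real. 2 * \<bar>t\<bar>) \<longlongrightarrow> 0) (at 0)"
      by (auto intro!: tendsto_eq_intros)
  qed
  then show ?thesis using True by (simp add: isCont_def)
qed

lemma continuous_on_nonlin:
  "p > 4 \<Longrightarrow> continuous_on S f \<Longrightarrow> continuous_on S (\<lambda>z. nonlin p (f z))"
  by (rule continuous_on_compose2[where t = UNIV])
     (auto simp: continuous_on_eq_continuous_at isCont_nonlin)

lemma continuous_on_potential:
  "p > 4 \<Longrightarrow> continuous_on S f \<Longrightarrow> continuous_on S (\<lambda>z. potential p (f z))"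
  by (rule continuous_on_compose2[where t = UNIV])
     (auto simp: continuous_on_eq_continuous_at intro: DERIV_isCont has_derivative_potential)

section \<open>Concavity in the p-th powers of the fibre coordinates\<close>

text \<open>In the coordinates X = s^p, Y = t^p the monomial is X^(i/p) * Y^(j/p). Its exponents sum
  to at most 1, so it is concave and lies below its tangent plane at (1, 1). The proof is Jensen's
  inequality for exp, that is, weighted AM-GM.\<close>

lemma monomial_le_tangent:
  fixes s t p :: real
  assumes "s > 0" "t > 0" "p > 0" "real i + real j \<le> p"
  shows "s ^ i * t ^ j \<le> 1 + i * ((s powr p - 1) / p) + j * ((t powr p - 1) / p)"
proof -
  define \<alpha> \<beta> where "\<alpha> = i / p" and "\<beta> = j / p"
  define c d where "c = p * ln s" and "d = p * ln t"
  define z where "z = \<alpha> * c + \<beta> * d"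
  have coeff: "\<alpha> \<ge> 0" "\<beta> \<ge> 0" "1 - \<alpha> - \<beta> \<ge> 0"
    using assms by (auto simp: \<alpha>_def \<beta>_def diff_diff_eq simp flip: add_divide_distrib)
  have tangent: "exp z * (1 + (y - z)) \<le> exp y" for y
    using exp_ge_add_one_self[of "y - z"] mult_left_mono[of "1 + (y - z)" "exp (y - z)" "exp z"]
    by (simp flip: exp_add)
  \<comment> \<open>The point z is the weighted mean of c, d and 0, so the linear parts of the three
    tangent lines of exp at z cancel.\<close>
  have "exp z = \<alpha> * (exp z * (1 + (c - z))) + \<beta> * (exp z * (1 + (d - z)))
      + (1 - \<alpha> - \<beta>) * (exp z * (1 + (0 - z)))"
    by (simp add: z_def algebra_simps)
  also have "\<dots> \<le> \<alpha> * exp c + \<beta> * exp d + (1 - \<alpha> - \<beta>) * exp 0"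
    by (intro add_mono mult_left_mono tangent coeff)
  also have "\<dots> = 1 + i * ((s powr p - 1) / p) + j * ((t powr p - 1) / p)"
    using assms by (simp add: \<alpha>_def \<beta>_def c_def d_def powr_def field_simps)
  also have "exp z = s ^ i * t ^ j"
  proof -
    have "z = i * ln s + j * ln t"
      using assms by (simp add: z_def \<alpha>_def \<beta>_def c_def d_def)
    then show ?thesis using assms by (simp add: exp_add exp_of_nat_mult)
  qed
  finally show ?thesis .
qed

text \<open>With X = s^p this is 2/p^2 times the amount by which X ln X exceeds its tangent X - 1 at
  X = 1.\<close>

definition entropy_gap :: "real \<Rightarrow> real \<Rightarrow> real" where
  "entropy_gap p s = 2 / p\<^sup>2 * (1 - s powr p + s powr p * (p * ln s))"

lemma entropy_gap_pos:
  assumes "s > 0" "p > 0" "s \<noteq> 1"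
  shows "entropy_gap p s > 0"
proof -
  \<comment> \<open>Equality in ln x \<le> x - 1 holds only at x = 1; this is the source of
    strictness.\<close>
  have "- p * ln s \<noteq> exp (- p * ln s) - 1"
    using ln_eq_minus_one[of "exp (- p * ln s)"] assms by auto
  then have "1 - p * ln s < exp (- p * ln s)"
    using exp_ge_add_one_self[of "- p * ln s"] by linarith
  then have "s powr p * (1 - p * ln s) < s powr p * exp (- p * ln s)"
    using assms by (intro mult_strict_left_mono) auto
  also have "\<dots> = 1" using assms by (simp add: powr_def flip: exp_add)
  finally have "0 < 1 - s powr p + s powr p * (p * ln s)" by (simp add: algebra_simps)
  then show ?thesis unfolding entropy_gap_def using assms by (intro mult_pos_pos) auto
qed

lemma entropy_gap_nonneg: "s > 0 \<Longrightarrow> p > 0 \<Longrightarrow> entropy_gap p s \<ge> 0"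
  using entropy_gap_pos[of s p] by (cases "s = 1") (auto simp: entropy_gap_def)

text \<open>As a function of X = s^p the left-hand side is an affine function minus a multiple of X
  ln X. Expanding X ln X around X = 1 leaves a linear term and the entropy gap, with no further
  error.\<close>

lemma potential_scale:
  assumes "s > 0" "p > 0"
  shows "potential p (s * x) =
    potential p x - (s powr p - 1) / p * (\<bar>x\<bar> powr p * ln (x\<^sup>2)) - entropy_gap p s * \<bar>x\<bar> powr p"
proof (cases "x = 0")
  case False
  have "ln ((s * x)\<^sup>2) = 2 * ln s + ln (x\<^sup>2)"
    using False assms by (simp add: power_mult_distrib ln_mult ln_realpow)
  moreover have "\<bar>s * x\<bar> powr p = s powr p * \<bar>x\<bar> powr p"
    using assms by (simp add: abs_mult powr_mult)
  ultimately show ?thesis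
    using assms by (simp add: potential_def entropy_gap_def field_simps power2_eq_square)
qed simp

section \<open>The functional on a finite domain\<close>

lemma finite_adj: "finite {y. adj x y}"
proof (rule finite_subset)
  show "{y. adj x y} \<subseteq> vec_lambda ` (PiE UNIV (\<lambda>i. {x $ i - 1..x $ i + 1}))"
  proof
    fix y assume "y \<in> {y. adj x y}"
    then have "(\<Sum>i\<in>UNIV. \<bar>x $ i - y $ i\<bar>) = 1" by (simp add: adj_def)
    then have "\<bar>x $ i - y $ i\<bar> \<le> 1" for i
      using member_le_sum[of i UNIV "\<lambda>i. \<bar>x $ i - y $ i\<bar>"] by simp
    then have "vec_nth y \<in> PiE UNIV (\<lambda>i. {x $ i - 1..x $ i + 1})"
      by (auto simp: abs_le_iff algebra_simps)
    then show "y \<in> vec_lambda ` (PiE UNIV (\<lambda>i. {x $ i - 1..x $ i + 1}))"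
      by (intro image_eqI[of _ _ "vec_nth y"]) auto
  qed
  show "finite (vec_lambda ` (PiE UNIV (\<lambda>i. {x $ i - 1..x $ i + 1})))"
    by (intro finite_imageI finite_PiE) auto
qed

lemma finite_vboundary: "finite A \<Longrightarrow> finite (vboundary A)"
  by (rule finite_subset[of _ "\<Union>x\<in>A. {y. adj x y}"]) (auto simp: vboundary_def finite_adj)

section \<open>The gradient form and functions split by sign\<close>

lemma grad_prod_comb_left:
  "grad_prod (\<lambda>x. s * u x + t * v x) w z = s * grad_prod u w z + t * grad_prod v w z"
  unfolding grad_prod_def sum_distrib_left sum.distrib[symmetric]
  by (rule sum.cong) (auto simp: algebra_simps)

lemma grad_prod_commute: "grad_prod u v z = grad_prod v u z"
  by (simp add: grad_prod_def mult.commute)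

lemma grad_sq_nonneg: "grad_sq u z \<ge> 0"
  by (simp add: grad_prod_def sum_nonneg)

text \<open>The pairs \<open>(u\<^sup>+, u\<^sup>-)\<close>, with \<open>Q \<le> 0\<close> as for \<^const>\<open>neg_part\<close>.\<close>

definition sign_split :: "(lattice \<Rightarrow> real) \<Rightarrow> (lattice \<Rightarrow> real) \<Rightarrow> bool" where
  "sign_split P Q \<longleftrightarrow> (\<forall>x. P x \<ge> 0 \<and> Q x \<le> 0 \<and> P x * Q x = 0)"

lemma sign_split_parts: "sign_split (pos_part u) (neg_part u)"
  by (auto simp: sign_split_def pos_part_def neg_part_def max_def min_def)

lemma parts_sum: "pos_part u x + neg_part u x = u x"
  by (auto simp: pos_part_def neg_part_def max_def min_def)

lemma sign_split_scale:
  "sign_split P Q \<Longrightarrow> s \<ge> 0 \<Longrightarrow> t \<ge> 0 \<Longrightarrow> sign_split (\<lambda>x. s * P x) (\<lambda>x. t * Q x)"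
  by (auto simp: sign_split_def mult_nonneg_nonpos)

lemma parts_of_sign_split:
  assumes "sign_split P Q"
  shows "pos_part (\<lambda>x. P x + Q x) = P" "neg_part (\<lambda>x. P x + Q x) = Q"
proof -
  have *: "P x \<ge> 0 \<and> Q x \<le> 0 \<and> (P x = 0 \<or> Q x = 0)" for x
    using assms by (simp add: sign_split_def)
  show "pos_part (\<lambda>x. P x + Q x) = P" "neg_part (\<lambda>x. P x + Q x) = Q"
    using * by (fastforce simp: pos_part_def neg_part_def fun_eq_iff max_def min_def)+
qed

text \<open>In each edge term the products taken at one point vanish and the mixed products
  \<open>P y * Q z\<close> are nonpositive. On a graph this coupling of the two parts need not be
  zero, but it has a sign.\<close>

lemma grad_prod_sign_split_nonneg:
  assumes "sign_split P Q"
  shows "grad_prod P Q z \<ge> 0"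
proof -
  have "(P y - P z) * (Q y - Q z) \<ge> 0" for y
  proof -
    have "P y * Q z \<le> 0" "P z * Q y \<le> 0" "P y * Q y = 0" "P z * Q z = 0"
      using assms by (auto simp: sign_split_def mult_nonneg_nonpos)
    moreover have "(P y - P z) * (Q y - Q z) = P y * Q y + P z * Q z - P y * Q z - P z * Q y"
      by (simp add: algebra_simps)
    ultimately show ?thesis by linarith
  qed
  then show ?thesis by (simp add: grad_prod_def sum_nonneg)
qed

text \<open>Finiteness of the domain turns every integral into a finite sum, and p > 4 places the
  Kirchhoff term, of degree 4, below the power of the logarithmic term.\<close>

locale kirchhoff =
  fixes a b p :: real and \<Omega> :: "lattice set"
  assumes a_pos: "a > 0" and b_pos: "b > 0" and p_gt: "p > 4" and finite_dom: "finite \<Omega>"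
begin

definition supp_fun :: "(lattice \<Rightarrow> real) set" where
  "supp_fun = {u. \<forall>x. x \<notin> \<Omega> \<longrightarrow> u x = 0}"

definition dirichlet :: "(lattice \<Rightarrow> real) \<Rightarrow> (lattice \<Rightarrow> real) \<Rightarrow> real" where
  "dirichlet u v = (\<Sum>x\<in>\<Omega> \<union> vboundary \<Omega>. grad_prod u v x)"

abbreviation "J \<equiv> energy a b p \<Omega>"
abbreviation "J' \<equiv> energy_deriv a b p \<Omega>"

lemma finite_closure: "finite (\<Omega> \<union> vboundary \<Omega>)"
  using finite_dom finite_vboundary by blast

lemma dirichlet_comb_left:
  "dirichlet (\<lambda>x. s * u x + t * v x) w = s * dirichlet u w + t * dirichlet v w"
  by (simp add: dirichlet_def grad_prod_comb_left sum.distrib sum_distrib_left)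

lemma dirichlet_commute: "dirichlet u v = dirichlet v u"
  by (simp add: dirichlet_def grad_prod_commute)

lemma dirichlet_comb_right:
  "dirichlet w (\<lambda>x. s * u x + t * v x) = s * dirichlet w u + t * dirichlet w v"
  using dirichlet_comb_left[of s u t v w] by (simp add: dirichlet_commute)

lemma dirichlet_scale:
  "dirichlet (\<lambda>x. s * u x) w = s * dirichlet u w" "dirichlet w (\<lambda>x. s * u x) = s * dirichlet w u"
  using dirichlet_comb_left[of s u 0 u w] dirichlet_comb_right[of w s u 0 u] by simp_all

lemma dirichlet_comb_self:
  "dirichlet (\<lambda>x. s * u x + t * v x) (\<lambda>x. s * u x + t * v x) =
    s\<^sup>2 * dirichlet u u + t\<^sup>2 * dirichlet v v + 2 * s * t * dirichlet u v"
  by (simp add: dirichlet_comb_left dirichlet_comb_right dirichlet_commute[of v u] algebra_simps power2_eq_square)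

lemma dirichlet_nonneg: "dirichlet u u \<ge> 0"
  by (simp add: dirichlet_def sum_nonneg grad_sq_nonneg)

lemma dirichlet_sign_split_nonneg: "sign_split P Q \<Longrightarrow> dirichlet P Q \<ge> 0"
  by (simp add: dirichlet_def sum_nonneg grad_prod_sign_split_nonneg)

lemma dirichlet_pos:
  assumes "u \<in> supp_fun" "u \<noteq> (\<lambda>x. 0)"
  shows "dirichlet u u > 0"
proof -
  define S where "S = {x. u x \<noteq> 0}"
  have "S \<subseteq> \<Omega>" "S \<noteq> {}" using assms by (auto simp: S_def supp_fun_def)
  then have "finite S" using finite_dom finite_subset by blast
  \<comment> \<open>The edge leaving the support at an extremal point carries a nonzero gradient.\<close>
  then obtain x where x: "x \<in> S" "\<And>z. z \<in> S \<Longrightarrow> z $ 1 \<le> x $ 1"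
    using \<open>S \<noteq> {}\<close> Max_in[of "(\<lambda>z. z $ 1) ` S"] Max_ge[of "(\<lambda>z. z $ 1) ` S"] by fastforce
  define y where "y = x + axis 1 1"
  have "adj x y" by (simp add: adj_def y_def sum_3 axis_def)
  have "y \<notin> S" using x(2)[of y] by (auto simp: y_def axis_def)
  then have "u y = 0" by (simp add: S_def)
  have "0 < (u y - u x)\<^sup>2" using x(1) \<open>u y = 0\<close> by (simp add: S_def)
  also have "\<dots> \<le> (\<Sum>y\<in>{y. adj x y}. (u y - u x)\<^sup>2)"
    using finite_adj \<open>adj x y\<close> by (intro member_le_sum) auto
  finally have "0 < grad_sq u x" by (simp add: grad_prod_def power2_eq_square)
  also have "\<dots> \<le> dirichlet u u"
    unfolding dirichlet_def using finite_closure x(1) \<open>S \<subseteq> \<Omega>\<close>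
    by (intro member_le_sum) (auto simp: grad_sq_nonneg)
  finally show ?thesis .
qed

lemma H01_norm_square: "(H01_norm a \<Omega> u)\<^sup>2 = a * dirichlet u u + (\<Sum>x\<in>\<Omega>. (u x)\<^sup>2)"
proof -
  have "a * dirichlet u u + (\<Sum>x\<in>\<Omega>. (u x)\<^sup>2) \<ge> 0"
    using a_pos dirichlet_nonneg by (simp add: sum_nonneg)
  then show ?thesis
    using finite_closure finite_dom
    by (simp add: H01_norm_def lebesgue_integral_count_space_finite dirichlet_def sum_distrib_left)
qed

lemma energy_eq:
  "J u = 1/2 * (a * dirichlet u u + (\<Sum>x\<in>\<Omega>. (u x)\<^sup>2)) + b/4 * (dirichlet u u)\<^sup>2
    + (\<Sum>x\<in>\<Omega>. potential p (u x))"
  unfolding energy_def H01_norm_square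
  using finite_closure finite_dom
  by (simp add: lebesgue_integral_count_space_finite potential_def
      sum_subtractf sum_distrib_left sum_divide_distrib flip: dirichlet_def)

lemma energy_deriv_eq:
  "J' u \<phi> = a * dirichlet u \<phi> + (\<Sum>x\<in>\<Omega>. u x * \<phi> x) + b * dirichlet u u * dirichlet u \<phi>
    - (\<Sum>x\<in>\<Omega>. nonlin p (u x) * \<phi> x)"
  unfolding energy_deriv_def
  using finite_closure finite_dom
  by (simp add: lebesgue_integral_count_space_finite nonlin_def mult_ac
      flip: dirichlet_def sum_distrib_left)

text \<open>Vanishing outside \<Omega> passes to pointwise limits. Conversely, a function supported
  in the finite set \<Omega> already belongs to \<open>Cc\<close>, and the constant sequence
  represents it.\<close>

lemma H01_eq: "H01 a \<Omega> = supp_fun"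
proof
  show "H01 a \<Omega> \<subseteq> supp_fun"
  proof
    fix u assume "u \<in> H01 a \<Omega>"
    then obtain \<phi> where \<phi>: "\<And>n::nat. \<phi> n \<in> Cc \<Omega>" "\<And>x. (\<lambda>n. \<phi> n x) \<longlonglongrightarrow> u x"
      unfolding H01_def by blast
    have "u x = 0" if "x \<notin> \<Omega>" for x
    proof -
      have "\<phi> n x = 0" for n using \<phi>(1)[of n] that by (auto simp: Cc_def)
      with \<phi>(2)[of x] show ?thesis by (simp add: LIMSEQ_const_iff)
    qed
    then show "u \<in> supp_fun" by (simp add: supp_fun_def)
  qed
  show "supp_fun \<subseteq> H01 a \<Omega>"
  proof
    fix u assume u: "u \<in> supp_fun"
    then have "{x. u x \<noteq> 0} \<subseteq> \<Omega>" by (auto simp: supp_fun_def)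
    then have "u \<in> Cc \<Omega>" using finite_dom finite_subset by (auto simp: Cc_def)
    moreover have "H01_norm a \<Omega> (\<lambda>x. u x - u x) = 0"
      by (simp add: H01_norm_def grad_prod_def)
    ultimately show "u \<in> H01 a \<Omega>"
      unfolding H01_def by (intro CollectI exI[of _ "\<lambda>_. u"]) auto
  qed
qed

lemma supp_fun_comb:
  "u \<in> supp_fun \<Longrightarrow> v \<in> supp_fun \<Longrightarrow> (\<lambda>x. s * u x + t * v x) \<in> supp_fun"
  by (simp add: supp_fun_def)

lemma supp_fun_parts:
  "u \<in> supp_fun \<Longrightarrow> pos_part u \<in> supp_fun" "u \<in> supp_fun \<Longrightarrow> neg_part u \<in> supp_fun"
  by (simp_all add: supp_fun_def pos_part_def neg_part_def)

lemma energy_deriv_comb: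
  "J' u (\<lambda>x. s * \<phi> x + t * \<psi> x) = s * J' u \<phi> + t * J' u \<psi>"
  unfolding energy_deriv_eq dirichlet_comb_right
  by (simp add: algebra_simps sum.distrib sum_distrib_left)

lemma energy_deriv_scale: "J' u (\<lambda>x. s * \<phi> x) = s * J' u \<phi>"
  using energy_deriv_comb[of u s \<phi> 0 \<phi>] by simp

lemma energy_deriv_self: "J' u u = J' u (pos_part u) + J' u (neg_part u)"
  using energy_deriv_comb[of u 1 "pos_part u" 1 "neg_part u"] by (simp add: parts_sum)

text \<open>On a line the Dirichlet form is a quadratic polynomial in \<tau> and the remaining terms
  are finite sums, so the one-variable chain rule suffices. All critical point arguments below use
  derivatives along lines only.\<close>

lemma has_derivative_energy:
  "((\<lambda>\<tau>. J (\<lambda>x. w x + \<tau> * \<psi> x)) has_real_derivative J' (\<lambda>x. w x + \<tau> * \<psi> x) \<psi>) (at \<tau>)"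
proof -
  define D0 D1 D2 where "D0 = dirichlet w w" and "D1 = dirichlet w \<psi>" and "D2 = dirichlet \<psi> \<psi>"
  have D: "dirichlet (\<lambda>x. w x + \<tau> * \<psi> x) (\<lambda>x. w x + \<tau> * \<psi> x) = D0 + 2 * \<tau> * D1 + \<tau>\<^sup>2 * D2" for \<tau>
    using dirichlet_comb_self[of 1 w \<tau> \<psi>] by (simp add: D0_def D1_def D2_def)
  have D': "dirichlet (\<lambda>x. w x + \<tau> * \<psi> x) \<psi> = D1 + \<tau> * D2" for \<tau>
    using dirichlet_comb_left[of 1 w \<tau> \<psi> \<psi>] by (simp add: D1_def D2_def)
  have pot: "((\<lambda>\<tau>. potential p (w x + \<tau> * \<psi> x)) has_real_derivative
      - nonlin p (w x + \<tau> * \<psi> x) * \<psi> x) (at \<tau>)" for x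
    by (rule DERIV_chain2[where f = "potential p", OF has_derivative_potential[OF p_gt]])
       (auto intro!: derivative_eq_intros)
  have "((\<lambda>\<tau>. 1/2 * (a * (D0 + 2 * \<tau> * D1 + \<tau>\<^sup>2 * D2) + (\<Sum>x\<in>\<Omega>. (w x + \<tau> * \<psi> x)\<^sup>2))
        + b/4 * (D0 + 2 * \<tau> * D1 + \<tau>\<^sup>2 * D2)\<^sup>2 + (\<Sum>x\<in>\<Omega>. potential p (w x + \<tau> * \<psi> x)))
      has_real_derivative
        1/2 * (a * (2 * D1 + 2 * \<tau> * D2) + (\<Sum>x\<in>\<Omega>. 2 * (w x + \<tau> * \<psi> x) * \<psi> x))
        + b/4 * (2 * (D0 + 2 * \<tau> * D1 + \<tau>\<^sup>2 * D2) * (2 * D1 + 2 * \<tau> * D2))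
        + (\<Sum>x\<in>\<Omega>. - nonlin p (w x + \<tau> * \<psi> x) * \<psi> x)) (at \<tau>)"
    by (intro DERIV_add DERIV_cmult DERIV_sum pot) (auto intro!: derivative_eq_intros DERIV_sum)
  also have "1/2 * (a * (2 * D1 + 2 * \<tau> * D2) + (\<Sum>x\<in>\<Omega>. 2 * (w x + \<tau> * \<psi> x) * \<psi> x))
        + b/4 * (2 * (D0 + 2 * \<tau> * D1 + \<tau>\<^sup>2 * D2) * (2 * D1 + 2 * \<tau> * D2))
        + (\<Sum>x\<in>\<Omega>. - nonlin p (w x + \<tau> * \<psi> x) * \<psi> x) = J' (\<lambda>x. w x + \<tau> * \<psi> x) \<psi>"
  proof -
    have "(\<Sum>x\<in>\<Omega>. 2 * (w x + \<tau> * \<psi> x) * \<psi> x) = 2 * (\<Sum>x\<in>\<Omega>. (w x + \<tau> * \<psi> x) * \<psi> x)"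
      by (simp only: sum_distrib_left mult.assoc)
    moreover have "(\<Sum>x\<in>\<Omega>. - nonlin p (w x + \<tau> * \<psi> x) * \<psi> x) = - (\<Sum>x\<in>\<Omega>. nonlin p (w x + \<tau> * \<psi> x) * \<psi> x)"
      by (simp add: sum_negf)
    ultimately show ?thesis
      unfolding energy_deriv_eq D D' by (simp only:) (simp add: algebra_simps)
  qed
  finally show ?thesis unfolding energy_eq D .
qed

text \<open>Coordinatewise continuity of a family is what is asked for. This covers both real
  parameters such as (s, t, \<epsilon>) and the identity on the function space with its product
  topology.\<close>

lemma continuous_on_dirichlet:
  assumes "\<And>x. continuous_on S (\<lambda>z. f z x)" "\<And>x. continuous_on S (\<lambda>z. g z x)"
  shows "continuous_on S (\<lambda>z. dirichlet (f z) (g z))"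
  unfolding dirichlet_def grad_prod_def by (intro continuous_intros assms)

lemma continuous_on_energy:
  assumes "\<And>x. continuous_on S (\<lambda>z. f z x)"
  shows "continuous_on S (\<lambda>z. J (f z))"
  unfolding energy_eq
  by (intro continuous_intros continuous_on_dirichlet continuous_on_potential p_gt assms)

lemma continuous_on_energy_deriv:
  assumes "\<And>x. continuous_on S (\<lambda>z. f z x)" "\<And>x. continuous_on S (\<lambda>z. g z x)"
  shows "continuous_on S (\<lambda>z. J' (f z) (g z))"
  unfolding energy_deriv_eq
  by (intro continuous_intros continuous_on_dirichlet continuous_on_nonlin p_gt assms)

section \<open>Fibering over the two signs\<close>

lemma sign_split_disjoint: "sign_split P Q \<Longrightarrow> P x = 0 \<or> Q x = 0"
  by (simp add: sign_split_def)

lemma sum_disjoint: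
  assumes "sign_split P Q" "F 0 = (0::real)"
  shows "(\<Sum>x\<in>\<Omega>. F (s * P x + t * Q x)) = (\<Sum>x\<in>\<Omega>. F (s * P x)) + (\<Sum>x\<in>\<Omega>. F (t * Q x))"
  unfolding sum.distrib[symmetric]
proof (rule sum.cong)
  show "F (s * P x + t * Q x) = F (s * P x) + F (t * Q x)" for x
    using sign_split_disjoint[OF assms(1), of x] assms(2) by auto
qed simp

text \<open>The local sums separate because the supports are disjoint; only the Dirichlet form
  couples the two signs. Every coefficient of a monomial in s and t is nonnegative.\<close>

lemma energy_fiber:
  assumes "sign_split P Q"
  shows "J (\<lambda>x. s * P x + t * Q x) =
    1/2 * (s\<^sup>2 * (a * dirichlet P P + (\<Sum>x\<in>\<Omega>. (P x)\<^sup>2)) + t\<^sup>2 * (a * dirichlet Q Q + (\<Sum>x\<in>\<Omega>. (Q x)\<^sup>2))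
      + 2 * s * t * (a * dirichlet P Q))
    + b/4 * (s\<^sup>2 * dirichlet P P + t\<^sup>2 * dirichlet Q Q + 2 * s * t * dirichlet P Q)\<^sup>2
    + (\<Sum>x\<in>\<Omega>. potential p (s * P x)) + (\<Sum>x\<in>\<Omega>. potential p (t * Q x))"
  unfolding energy_eq dirichlet_comb_self
    sum_disjoint[OF assms, of "\<lambda>y. y\<^sup>2", simplified] sum_disjoint[OF assms, of "potential p", simplified]
  by (simp add: power_mult_distrib sum_distrib_left[symmetric] algebra_simps)

text \<open>These are the partial derivatives at s = t = 1 of the energy on the fibre.\<close>

lemma energy_deriv_fiber:
  assumes "sign_split P Q"
  shows "J' (\<lambda>x. P x + Q x) P = a * (dirichlet P P + dirichlet P Q) + (\<Sum>x\<in>\<Omega>. (P x)\<^sup>2)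
      + b * (dirichlet P P + dirichlet Q Q + 2 * dirichlet P Q) * (dirichlet P P + dirichlet P Q)
      - (\<Sum>x\<in>\<Omega>. \<bar>P x\<bar> powr p * ln ((P x)\<^sup>2))"
    and "J' (\<lambda>x. P x + Q x) Q = a * (dirichlet Q Q + dirichlet P Q) + (\<Sum>x\<in>\<Omega>. (Q x)\<^sup>2)
      + b * (dirichlet P P + dirichlet Q Q + 2 * dirichlet P Q) * (dirichlet Q Q + dirichlet P Q)
      - (\<Sum>x\<in>\<Omega>. \<bar>Q x\<bar> powr p * ln ((Q x)\<^sup>2))"
proof -
  have D: "dirichlet (\<lambda>x. P x + Q x) (\<lambda>x. P x + Q x) = dirichlet P P + dirichlet Q Q + 2 * dirichlet P Q"
    "dirichlet (\<lambda>x. P x + Q x) P = dirichlet P P + dirichlet P Q"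
    "dirichlet (\<lambda>x. P x + Q x) Q = dirichlet Q Q + dirichlet P Q"
    using dirichlet_comb_self[of 1 P 1 Q] dirichlet_comb_left[of 1 P 1 Q P] dirichlet_comb_left[of 1 P 1 Q Q]
    by (simp_all add: dirichlet_commute[of Q P])
  note disj = sign_split_disjoint[OF assms]
  have L: "(\<Sum>x\<in>\<Omega>. (P x + Q x) * P x) = (\<Sum>x\<in>\<Omega>. (P x)\<^sup>2)"
    "(\<Sum>x\<in>\<Omega>. (P x + Q x) * Q x) = (\<Sum>x\<in>\<Omega>. (Q x)\<^sup>2)"
    by (rule sum.cong; use disj in \<open>fastforce simp: power2_eq_square algebra_simps\<close>)+
  have N: "(\<Sum>x\<in>\<Omega>. nonlin p (P x + Q x) * P x) = (\<Sum>x\<in>\<Omega>. \<bar>P x\<bar> powr p * ln ((P x)\<^sup>2))"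
    "(\<Sum>x\<in>\<Omega>. nonlin p (P x + Q x) * Q x) = (\<Sum>x\<in>\<Omega>. \<bar>Q x\<bar> powr p * ln ((Q x)\<^sup>2))"
    by (rule sum.cong; use disj in \<open>force simp flip: nonlin_mult_self\<close>)+
  show "J' (\<lambda>x. P x + Q x) P = a * (dirichlet P P + dirichlet P Q) + (\<Sum>x\<in>\<Omega>. (P x)\<^sup>2)
      + b * (dirichlet P P + dirichlet Q Q + 2 * dirichlet P Q) * (dirichlet P P + dirichlet P Q)
      - (\<Sum>x\<in>\<Omega>. \<bar>P x\<bar> powr p * ln ((P x)\<^sup>2))"
    "J' (\<lambda>x. P x + Q x) Q = a * (dirichlet Q Q + dirichlet P Q) + (\<Sum>x\<in>\<Omega>. (Q x)\<^sup>2)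
      + b * (dirichlet P P + dirichlet Q Q + 2 * dirichlet P Q) * (dirichlet Q Q + dirichlet P Q)
      - (\<Sum>x\<in>\<Omega>. \<bar>Q x\<bar> powr p * ln ((Q x)\<^sup>2))"
    unfolding energy_deriv_eq D L N by simp_all
qed

lemma sum_potential_scale:
  assumes "s > 0"
  shows "(\<Sum>x\<in>\<Omega>. potential p (s * u x)) = (\<Sum>x\<in>\<Omega>. potential p (u x))
    - (s powr p - 1) / p * (\<Sum>x\<in>\<Omega>. \<bar>u x\<bar> powr p * ln ((u x)\<^sup>2))
    - entropy_gap p s * (\<Sum>x\<in>\<Omega>. \<bar>u x\<bar> powr p)"
proof -
  have "p > 0" using p_gt by simp
  show ?thesis
    by (simp only: potential_scale[OF assms \<open>p > 0\<close>] sum_subtractf sum_distrib_left)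
qed

lemma sum_powr_pos:
  assumes "u \<in> supp_fun" "u \<noteq> (\<lambda>x. 0)"
  shows "(\<Sum>x\<in>\<Omega>. \<bar>u x\<bar> powr p) > 0"
proof -
  obtain x where "u x \<noteq> 0" using assms(2) by auto
  moreover from this have "x \<in> \<Omega>" using assms(1) by (auto simp: supp_fun_def)
  ultimately show ?thesis using finite_dom by (intro sum_pos2[of _ x]) auto
qed

text \<open>In the coordinates \<open>(s\<^sup>p, t\<^sup>p)\<close> the energy on a fibre is strictly concave: the right-hand side is
  its tangent plane at \<open>(1, 1)\<close>.\<close>

lemma energy_fiber_gap:
  assumes PQ: "sign_split P Q" and st: "s > 0" "t > 0"
  shows "J (\<lambda>x. s * P x + t * Q x)
      + entropy_gap p s * (\<Sum>x\<in>\<Omega>. \<bar>P x\<bar> powr p)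
      + entropy_gap p t * (\<Sum>x\<in>\<Omega>. \<bar>Q x\<bar> powr p)
    \<le> J (\<lambda>x. P x + Q x) + (s powr p - 1) / p * J' (\<lambda>x. P x + Q x) P + (t powr p - 1) / p * J' (\<lambda>x. P x + Q x) Q"
proof -
  define S T where "S = (s powr p - 1) / p" and "T = (t powr p - 1) / p"
  define d e c where "d = dirichlet P P" and "e = dirichlet Q Q" and "c = dirichlet P Q"
  define lP lQ where "lP = (\<Sum>x\<in>\<Omega>. (P x)\<^sup>2)" and "lQ = (\<Sum>x\<in>\<Omega>. (Q x)\<^sup>2)"
  have nn: "d \<ge> 0" "e \<ge> 0" "c \<ge> 0" "lP \<ge> 0" "lQ \<ge> 0"
    using dirichlet_nonneg dirichlet_sign_split_nonneg[OF PQ]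
    by (auto simp: d_def e_def c_def lP_def lQ_def sum_nonneg)
  \<comment> \<open>Degree at most 4 < p; the exponents listed next are those that occur in the
    quadratic and quartic terms.\<close>
  have mono: "s ^ i * t ^ j \<le> 1 + i * S + j * T" if "i + j \<le> 4" for i j
    unfolding S_def T_def using that p_gt st by (intro monomial_le_tangent) auto
  have m20: "s\<^sup>2 \<le> 1 + 2 * S" and m02: "t\<^sup>2 \<le> 1 + 2 * T" and m11: "s * t \<le> 1 + S + T"
    and m40: "s ^ 4 \<le> 1 + 4 * S" and m04: "t ^ 4 \<le> 1 + 4 * T" and m22: "s\<^sup>2 * t\<^sup>2 \<le> 1 + 2 * S + 2 * T"
    and m31: "s ^ 3 * t \<le> 1 + 3 * S + T" and m13: "s * t ^ 3 \<le> 1 + S + 3 * T"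
    using mono[of 2 0] mono[of 0 2] mono[of 1 1] mono[of 4 0] mono[of 0 4] mono[of 2 2] mono[of 3 1] mono[of 1 3]
    by simp_all
  \<comment> \<open>Quadratic (X) and quartic (Y) contributions to the partial derivatives in the
    directions P and Q.\<close>
  define XP XQ YP YQ where "XP = a * (d + c) + lP" and "XQ = a * (e + c) + lQ"
    and "YP = b * (d + e + 2 * c) * (d + c)" and "YQ = b * (d + e + 2 * c) * (e + c)"
  have "s\<^sup>2 * (a * d + lP) + t\<^sup>2 * (a * e + lQ) + 2 * (s * t) * (a * c)
      \<le> (1 + 2 * S) * (a * d + lP) + (1 + 2 * T) * (a * e + lQ) + 2 * (1 + S + T) * (a * c)"
    using nn a_pos m20 m02 m11 by (intro add_mono mult_right_mono) auto
  also have "\<dots> = (a * d + lP + (a * e + lQ) + 2 * (a * c)) + 2 * (S * XP) + 2 * (T * XQ)"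
    unfolding XP_def XQ_def by algebra
  finally have quad: "s\<^sup>2 * (a * d + lP) + t\<^sup>2 * (a * e + lQ) + 2 * s * t * (a * c)
      \<le> (a * d + lP + (a * e + lQ) + 2 * (a * c)) + 2 * (S * XP) + 2 * (T * XQ)" 
    by (simp only: mult.assoc)
  \<comment> \<open>All coefficients of the expanded square are nonnegative, so the monomial bounds
    may be inserted term by term.\<close>
  have "(s\<^sup>2 * d + t\<^sup>2 * e + 2 * s * t * c)\<^sup>2
      = s ^ 4 * d\<^sup>2 + t ^ 4 * e\<^sup>2 + (s\<^sup>2 * t\<^sup>2) * (4 * c\<^sup>2 + 2 * (d * e)) + (s ^ 3 * t) * (4 * (d * c)) + (s * t ^ 3) * (4 * (e * c))"
    by algebra
  also have "\<dots> \<le> (1 + 4 * S) * d\<^sup>2 + (1 + 4 * T) * e\<^sup>2 + (1 + 2 * S + 2 * T) * (4 * c\<^sup>2 + 2 * (d * e))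
      + (1 + 3 * S + T) * (4 * (d * c)) + (1 + S + 3 * T) * (4 * (e * c))"
    using nn m40 m04 m22 m31 m13 by (intro add_mono mult_right_mono) auto
  also have "\<dots> = (d + e + 2 * c)\<^sup>2 + 4 * S * ((d + e + 2 * c) * (d + c)) + 4 * T * ((d + e + 2 * c) * (e + c))"
    by algebra
  finally have "b / 4 * (s\<^sup>2 * d + t\<^sup>2 * e + 2 * s * t * c)\<^sup>2
      \<le> b / 4 * ((d + e + 2 * c)\<^sup>2 + 4 * S * ((d + e + 2 * c) * (d + c)) + 4 * T * ((d + e + 2 * c) * (e + c)))"
    using b_pos by (intro mult_left_mono) auto
  also have "\<dots> = b / 4 * (d + e + 2 * c)\<^sup>2 + S * YP + T * YQ"
    by (simp add: YP_def YQ_def algebra_simps)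
  finally have quart: "b / 4 * (s\<^sup>2 * d + t\<^sup>2 * e + 2 * s * t * c)\<^sup>2
      \<le> b / 4 * (d + e + 2 * c)\<^sup>2 + S * YP + T * YQ" .
  define hP hQ HP HQ where "hP = (\<Sum>x\<in>\<Omega>. potential p (P x))" and "hQ = (\<Sum>x\<in>\<Omega>. potential p (Q x))"
    and "HP = (\<Sum>x\<in>\<Omega>. \<bar>P x\<bar> powr p * ln ((P x)\<^sup>2))" and "HQ = (\<Sum>x\<in>\<Omega>. \<bar>Q x\<bar> powr p * ln ((Q x)\<^sup>2))"
  have J1: "J (\<lambda>x. P x + Q x) = 1/2 * (a * d + lP + (a * e + lQ) + 2 * (a * c))
      + b / 4 * (d + e + 2 * c)\<^sup>2 + hP + hQ"
    using energy_fiber[OF PQ, of 1 1] by (simp add: d_def e_def c_def lP_def lQ_def hP_def hQ_def)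
  have Jst: "J (\<lambda>x. s * P x + t * Q x) =
      1/2 * (s\<^sup>2 * (a * d + lP) + t\<^sup>2 * (a * e + lQ) + 2 * s * t * (a * c))
      + b / 4 * (s\<^sup>2 * d + t\<^sup>2 * e + 2 * s * t * c)\<^sup>2
      + (hP - S * HP - entropy_gap p s * (\<Sum>x\<in>\<Omega>. \<bar>P x\<bar> powr p))
      + (hQ - T * HQ - entropy_gap p t * (\<Sum>x\<in>\<Omega>. \<bar>Q x\<bar> powr p))"
    unfolding energy_fiber[OF PQ] sum_potential_scale[OF st(1)] sum_potential_scale[OF st(2)]
      S_def T_def d_def e_def c_def lP_def lQ_def hP_def hQ_def HP_def HQ_def by simp
  have JP: "J' (\<lambda>x. P x + Q x) P = XP + YP - HP" "J' (\<lambda>x. P x + Q x) Q = XQ + YQ - HQ"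
    unfolding energy_deriv_fiber[OF PQ]
    by (simp_all add: XP_def YP_def XQ_def YQ_def HP_def HQ_def d_def e_def c_def lP_def lQ_def)
  have "J (\<lambda>x. s * P x + t * Q x) + entropy_gap p s * (\<Sum>x\<in>\<Omega>. \<bar>P x\<bar> powr p)
      + entropy_gap p t * (\<Sum>x\<in>\<Omega>. \<bar>Q x\<bar> powr p)
    \<le> 1/2 * ((a * d + lP + (a * e + lQ) + 2 * (a * c)) + 2 * (S * XP) + 2 * (T * XQ))
      + (b / 4 * (d + e + 2 * c)\<^sup>2 + S * YP + T * YQ) + (hP - S * HP) + (hQ - T * HQ)"
  proof -
    \<comment> \<open>The entropy gaps produced by the logarithmic term cancel those added on the
      left, leaving only the quadratic and quartic bounds.\<close>
    have lin: "x + y + (A - e') + (B - f) + e' + f \<le> x' + y' + A + B"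
      if "x \<le> x'" "y \<le> y'" for x y A B e' f x' y' :: real
      using that by linarith
    show ?thesis unfolding Jst by (rule lin[OF mult_left_mono[OF quad] quart]) simp
  qed
  also have "\<dots> = J (\<lambda>x. P x + Q x) + S * (XP + YP - HP) + T * (XQ + YQ - HQ)"
    unfolding J1 by (simp add: algebra_simps)
  finally show ?thesis unfolding JP S_def T_def .
qed

text \<open>Both slopes of the tangent plane vanish and the entropy gaps are nonnegative.\<close>

lemma energy_fiber_le:
  assumes "sign_split P Q" "s > 0" "t > 0"
    and "J' (\<lambda>x. P x + Q x) P = 0" "J' (\<lambda>x. P x + Q x) Q = 0"
  shows "J (\<lambda>x. s * P x + t * Q x) \<le> J (\<lambda>x. P x + Q x)"
proof -
  have "entropy_gap p s * (\<Sum>x\<in>\<Omega>. \<bar>P x\<bar> powr p) \<ge> 0"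
    "entropy_gap p t * (\<Sum>x\<in>\<Omega>. \<bar>Q x\<bar> powr p) \<ge> 0"
    using entropy_gap_nonneg assms p_gt by (auto intro!: mult_nonneg_nonneg sum_nonneg)
  then show ?thesis using energy_fiber_gap[OF assms(1-3)] assms(4,5) by simp
qed

text \<open>Away from (1, 1) at least one entropy gap is positive, and its weight is positive
  because P and Q are nonzero.\<close>

lemma energy_fiber_less:
  assumes "sign_split P Q" "s > 0" "t > 0"
    and "J' (\<lambda>x. P x + Q x) P = 0" "J' (\<lambda>x. P x + Q x) Q = 0"
    and "P \<in> supp_fun" "Q \<in> supp_fun" "P \<noteq> (\<lambda>x. 0)" "Q \<noteq> (\<lambda>x. 0)" "s \<noteq> 1 \<or> t \<noteq> 1"
  shows "J (\<lambda>x. s * P x + t * Q x) < J (\<lambda>x. P x + Q x)"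
proof -
  define X Y where "X = entropy_gap p s * (\<Sum>x\<in>\<Omega>. \<bar>P x\<bar> powr p)"
    and "Y = entropy_gap p t * (\<Sum>x\<in>\<Omega>. \<bar>Q x\<bar> powr p)"
  have "X \<ge> 0" "Y \<ge> 0"
    using entropy_gap_nonneg assms p_gt by (auto simp: X_def Y_def intro!: mult_nonneg_nonneg sum_nonneg)
  moreover have "X > 0 \<or> Y > 0"
    unfolding X_def Y_def
    using assms p_gt entropy_gap_pos[of s p] entropy_gap_pos[of t p] sum_powr_pos[of P] sum_powr_pos[of Q]
    by (auto intro: mult_pos_pos)
  moreover have "J (\<lambda>x. s * P x + t * Q x) + X + Y \<le> J (\<lambda>x. P x + Q x)"
    using energy_fiber_gap[OF assms(1-3)] assms(4,5) by (simp add: X_def Y_def)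
  ultimately show ?thesis by linarith
qed

text \<open>Squaring the total Dirichlet energy produces the mixed product 2 d e > 0. All other
  interactions contain c and are nonnegative.\<close>

lemma energy_superadditive:
  assumes "sign_split P Q" "P \<in> supp_fun" "Q \<in> supp_fun" "P \<noteq> (\<lambda>x. 0)" "Q \<noteq> (\<lambda>x. 0)"
  shows "J P + J Q < J (\<lambda>x. P x + Q x)"
proof -
  define d e c where "d = dirichlet P P" and "e = dirichlet Q Q" and "c = dirichlet P Q"
  have nn: "d > 0" "e > 0" "c \<ge> 0"
    using dirichlet_pos assms dirichlet_sign_split_nonneg by (auto simp: d_def e_def c_def)
  then have "(d + e + 2 * c)\<^sup>2 \<ge> (d + e)\<^sup>2" by (intro power_mono) auto
  moreover have "d * e > 0" using nn by simp
  ultimately have "d\<^sup>2 + e\<^sup>2 < (d + e + 2 * c)\<^sup>2" by (simp add: power2_sum)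
  then have "b / 4 * (d\<^sup>2 + e\<^sup>2) < b / 4 * (d + e + 2 * c)\<^sup>2"
    using b_pos by (intro mult_strict_left_mono) auto
  moreover have "a * c \<ge> 0" using a_pos nn by simp
  ultimately show ?thesis
    using energy_fiber[OF assms(1), of 1 1] energy_eq[of P] energy_eq[of Q]
    by (simp add: d_def e_def c_def distrib_left)
qed

lemma supp_fun_scale: "u \<in> supp_fun \<Longrightarrow> (\<lambda>x. s * u x) \<in> supp_fun"
  by (simp add: supp_fun_def)

lemma scale_neq_zero: "s \<noteq> 0 \<Longrightarrow> u \<noteq> (\<lambda>x. 0) \<Longrightarrow> (\<lambda>x. s * u x) \<noteq> (\<lambda>x. 0 :: real)"
  by (auto simp: fun_eq_iff)

lemma nodal_Nehari_iff:
  "u \<in> nodal_Nehari a b p \<Omega> \<longleftrightarrow> u \<in> supp_fun \<and> pos_part u \<noteq> (\<lambda>x. 0) \<and> neg_part u \<noteq> (\<lambda>x. 0)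
    \<and> J' u (pos_part u) = 0 \<and> J' u (neg_part u) = 0"
  by (auto simp: nodal_Nehari_def H01_eq)

lemma nodal_Nehari_fiberI:
  assumes "sign_split P Q" "P \<in> supp_fun" "Q \<in> supp_fun" "P \<noteq> (\<lambda>x. 0)" "Q \<noteq> (\<lambda>x. 0)" "s > 0" "t > 0"
    and "J' (\<lambda>x. s * P x + t * Q x) P = 0" "J' (\<lambda>x. s * P x + t * Q x) Q = 0"
  shows "(\<lambda>x. s * P x + t * Q x) \<in> nodal_Nehari a b p \<Omega>"
proof -
  have "sign_split (\<lambda>x. s * P x) (\<lambda>x. t * Q x)" using assms by (intro sign_split_scale) auto
  note parts = parts_of_sign_split[OF this]
  show ?thesis
    unfolding nodal_Nehari_iff parts
    using assms supp_fun_comb[of P Q s t] scale_neq_zero[of s P] scale_neq_zero[of t Q]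
    by (simp add: energy_deriv_scale)
qed

section \<open>Meeting the nodal Nehari set by maximising over a square\<close>

text \<open>The continuous energy has a maximum over the compact square, and \<open>boundary\<close>
  keeps it off the edges. At an interior maximum both partial derivatives vanish, and l \<ge> 0
  makes both coordinates positive. It is applied to a large square with l = 0 and to a small one
  around (1, 1).\<close>

lemma nodal_Nehari_of_fiber_max:
  assumes PQ: "sign_split P Q" "P \<in> supp_fun" "Q \<in> supp_fun" "P \<noteq> (\<lambda>x. 0)" "Q \<noteq> (\<lambda>x. 0)"
    and lr: "0 \<le> l" "l < r"
    and boundary: "\<And>s t. s \<in> {l..r} \<Longrightarrow> t \<in> {l..r} \<Longrightarrow> s = l \<or> s = r \<or> t = l \<or> t = r \<Longrightarrow>
      \<exists>s'\<in>{l..r}. \<exists>t'\<in>{l..r}. J (\<lambda>x. s * P x + t * Q x) < J (\<lambda>x. s' * P x + t' * Q x)"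
  shows "\<exists>s\<in>{l..r}. \<exists>t\<in>{l..r}. (\<lambda>x. s * P x + t * Q x) \<in> nodal_Nehari a b p \<Omega>"
proof -
  have "continuous_on ({l..r} \<times> {l..r}) (\<lambda>z. J (\<lambda>x. fst z * P x + snd z * Q x))"
    by (intro continuous_on_energy continuous_intros)
  then obtain z where z: "z \<in> {l..r} \<times> {l..r}"
    "\<And>z'. z' \<in> {l..r} \<times> {l..r} \<Longrightarrow> J (\<lambda>x. fst z' * P x + snd z' * Q x) \<le> J (\<lambda>x. fst z * P x + snd z * Q x)"
    using continuous_attains_sup[of "{l..r} \<times> {l..r}" "\<lambda>z. J (\<lambda>x. fst z * P x + snd z * Q x)"] lr
    by (auto simp: compact_Times)
  define s t where "s = fst z" and "t = snd z"
  have st: "s \<in> {l..r}" "t \<in> {l..r}" using z(1) by (auto simp: s_def t_def)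
  have max: "J (\<lambda>x. s' * P x + t' * Q x) \<le> J (\<lambda>x. s * P x + t * Q x)"
    if "s' \<in> {l..r}" "t' \<in> {l..r}" for s' t'
    using z(2)[of "(s', t')"] that by (simp add: s_def t_def)
  have "\<not> (s = l \<or> s = r \<or> t = l \<or> t = r)"
    using boundary[OF st] max by (meson not_le)
  then have int: "l < s" "s < r" "l < t" "t < r" using st by auto
  have "J' (\<lambda>x. s * P x + t * Q x) P = 0"
  proof (rule DERIV_local_max[of "\<lambda>\<tau>. J (\<lambda>x. s * P x + t * Q x + \<tau> * P x)" _ 0 "min (s - l) (r - s)"])
    show "((\<lambda>\<tau>. J (\<lambda>x. s * P x + t * Q x + \<tau> * P x)) has_real_derivative J' (\<lambda>x. s * P x + t * Q x) P) (at 0)"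
      using has_derivative_energy[of "\<lambda>x. s * P x + t * Q x" P 0] by simp
    show "\<forall>\<tau>. \<bar>0 - \<tau>\<bar> < min (s - l) (r - s) \<longrightarrow>
        J (\<lambda>x. s * P x + t * Q x + \<tau> * P x) \<le> J (\<lambda>x. s * P x + t * Q x + 0 * P x)"
    proof (intro allI impI)
      fix \<tau> assume "\<bar>0 - \<tau>\<bar> < min (s - l) (r - s)"
      then have "J (\<lambda>x. (s + \<tau>) * P x + t * Q x) \<le> J (\<lambda>x. s * P x + t * Q x)"
        using st by (intro max) auto
      then show "J (\<lambda>x. s * P x + t * Q x + \<tau> * P x) \<le> J (\<lambda>x. s * P x + t * Q x + 0 * P x)"
        by (simp add: algebra_simps)
    qed
  qed (use int in auto)
  moreover have "J' (\<lambda>x. s * P x + t * Q x) Q = 0"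
  proof (rule DERIV_local_max[of "\<lambda>\<tau>. J (\<lambda>x. s * P x + t * Q x + \<tau> * Q x)" _ 0 "min (t - l) (r - t)"])
    show "((\<lambda>\<tau>. J (\<lambda>x. s * P x + t * Q x + \<tau> * Q x)) has_real_derivative J' (\<lambda>x. s * P x + t * Q x) Q) (at 0)"
      using has_derivative_energy[of "\<lambda>x. s * P x + t * Q x" Q 0] by simp
    show "\<forall>\<tau>. \<bar>0 - \<tau>\<bar> < min (t - l) (r - t) \<longrightarrow>
        J (\<lambda>x. s * P x + t * Q x + \<tau> * Q x) \<le> J (\<lambda>x. s * P x + t * Q x + 0 * Q x)"
    proof (intro allI impI)
      fix \<tau> assume "\<bar>0 - \<tau>\<bar> < min (t - l) (r - t)"
      then have "J (\<lambda>x. s * P x + (t + \<tau>) * Q x) \<le> J (\<lambda>x. s * P x + t * Q x)"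
        using st by (intro max) auto
      then show "J (\<lambda>x. s * P x + t * Q x + \<tau> * Q x) \<le> J (\<lambda>x. s * P x + t * Q x + 0 * Q x)"
        by (simp add: algebra_simps)
    qed
  qed (use int in auto)
  ultimately show ?thesis
    using nodal_Nehari_fiberI[OF PQ, of s t] int lr st by (intro bexI[of _ s] bexI[of _ t]) auto
qed

lemma sum_square_pos:
  assumes "u \<in> supp_fun" "u \<noteq> (\<lambda>x. 0)"
  shows "(\<Sum>x\<in>\<Omega>. (u x)\<^sup>2) > 0"
proof -
  obtain x where "u x \<noteq> 0" using assms(2) by auto
  moreover from this have "x \<in> \<Omega>" using assms(1) by (auto simp: supp_fun_def)
  ultimately show ?thesis using finite_dom by (intro sum_pos2[of _ x]) auto
qed

lemma energy_minus: "J (\<lambda>x. - u x) = J u"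
  using dirichlet_comb_self[of "- 1" u 0 u] by (simp add: energy_eq)

text \<open>Values of modulus at most 1 have nonnegative potential, so adding P contributes
  nonnegative terms only, and its mass term is positive.\<close>

lemma energy_increases_from_axis:
  assumes PQ: "sign_split P Q" "P \<in> supp_fun" "P \<noteq> (\<lambda>x. 0)" and "\<And>x. \<bar>P x\<bar> \<le> 1" "t \<ge> 0"
  shows "J (\<lambda>x. 0 * P x + t * Q x) < J (\<lambda>x. 1 * P x + t * Q x)"
proof -
  have nn: "dirichlet P P \<ge> 0" "dirichlet Q Q \<ge> 0" "dirichlet P Q \<ge> 0" "(\<Sum>x\<in>\<Omega>. (P x)\<^sup>2) > 0"
    using dirichlet_nonneg dirichlet_sign_split_nonneg sum_square_pos PQ by auto
  have "(\<Sum>x\<in>\<Omega>. potential p (P x)) \<ge> 0"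
    using assms(4) p_gt by (intro sum_nonneg potential_nonneg) auto
  moreover have "b / 4 * (t\<^sup>2 * dirichlet Q Q)\<^sup>2 \<le> b / 4 * (dirichlet P P + t\<^sup>2 * dirichlet Q Q + 2 * t * dirichlet P Q)\<^sup>2"
    using nn assms b_pos by (intro mult_left_mono power_mono) auto
  moreover have "a * dirichlet P P \<ge> 0" "t * (a * dirichlet P Q) \<ge> 0" using nn assms a_pos by auto
  ultimately show ?thesis
    using nn(4) unfolding energy_fiber[OF PQ(1)] by (simp add: distrib_left)
qed

text \<open>For 0 \<le> t \<le> R the Dirichlet quantities are at most R^2 K, so the positive terms
  of the derivative in s at s = R are at most R^4 (a K + 1 + b K^2) = R^4 ln R. The logarithmic term
  is at least 2 R^4 ln R, so the derivative is negative.\<close>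

lemma energy_decreases_at_large_bump:
  assumes PQ: "sign_split P Q" and P: "P = (\<lambda>z. if z = y then 1 else 0)" "y \<in> \<Omega>"
    and K: "K = dirichlet P P + dirichlet Q Q + 2 * dirichlet P Q"
    and R: "R = exp (a * K + 1 + b * K\<^sup>2)" and t: "0 \<le> t" "t \<le> R"
  shows "\<exists>s\<in>{0..R}. J (\<lambda>x. R * P x + t * Q x) < J (\<lambda>x. s * P x + t * Q x)"
proof -
  define d e c where "d = dirichlet P P" and "e = dirichlet Q Q" and "c = dirichlet P Q"
  have nn: "d \<ge> 0" "e \<ge> 0" "c \<ge> 0"
    using dirichlet_nonneg dirichlet_sign_split_nonneg PQ by (auto simp: d_def e_def c_def)
  then have K0: "K \<ge> 0" by (simp add: K d_def e_def c_def)
  have "a * K + 1 + b * K\<^sup>2 > 0" using K0 a_pos b_pos by (intro add_nonneg_pos add_pos_nonneg) auto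
  then have R1: "R > 1" and lnR: "ln R = a * K + 1 + b * K\<^sup>2" "ln R > 0" unfolding R by auto
  have ss: "sign_split (\<lambda>x. R * P x) (\<lambda>x. t * Q x)"
    using PQ R1 t by (intro sign_split_scale) auto
  have sq: "(\<Sum>x\<in>\<Omega>. (R * P x)\<^sup>2) = R\<^sup>2"
  proof -
    have "(\<Sum>x\<in>\<Omega>. (R * P x)\<^sup>2) = (\<Sum>x\<in>\<Omega>. if x = y then R\<^sup>2 else 0)"
      by (rule sum.cong) (auto simp: P)
    then show ?thesis using P(2) finite_dom by simp
  qed
  have log: "(\<Sum>x\<in>\<Omega>. \<bar>R * P x\<bar> powr p * ln ((R * P x)\<^sup>2)) = R powr p * (2 * ln R)"
  proof -
    have "(\<Sum>x\<in>\<Omega>. \<bar>R * P x\<bar> powr p * ln ((R * P x)\<^sup>2)) = (\<Sum>x\<in>\<Omega>. if x = y then R powr p * (2 * ln R) else 0)"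
      using R1 by (intro sum.cong) (auto simp: P ln_realpow)
    then show ?thesis using P(2) finite_dom by simp
  qed
  have "t\<^sup>2 \<le> R\<^sup>2" using t by (intro power_mono)
  then have "R * t * c \<le> R\<^sup>2 * c" "t\<^sup>2 * e \<le> R\<^sup>2 * e"
    using t R1 nn by (auto intro!: mult_right_mono simp: power2_eq_square)
  moreover have "R\<^sup>2 * K = R\<^sup>2 * d + R\<^sup>2 * e + 2 * (R\<^sup>2 * c)"
    by (simp add: K d_def e_def c_def algebra_simps)
  moreover have "0 \<le> R\<^sup>2 * e" "0 \<le> R\<^sup>2 * c" using nn by auto
  ultimately have first: "R\<^sup>2 * d + R * t * c \<le> R\<^sup>2 * K"
    and total: "R\<^sup>2 * d + t\<^sup>2 * e + 2 * (R * t * c) \<le> R\<^sup>2 * K"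
    by linarith+
  have first0: "0 \<le> R\<^sup>2 * d + R * t * c" using nn t R1 by simp
  have p4: "R ^ 4 \<le> R powr p"
    using R1 p_gt powr_mono[of 4 p R] by simp
  have "J' (\<lambda>x. R * P x + t * Q x) (\<lambda>x. R * P x) =
      a * (R\<^sup>2 * d + R * t * c) + R\<^sup>2
      + b * (R\<^sup>2 * d + t\<^sup>2 * e + 2 * (R * t * c)) * (R\<^sup>2 * d + R * t * c) - R powr p * (2 * ln R)"
    unfolding energy_deriv_fiber(1)[OF ss] sq log dirichlet_scale d_def e_def c_def
    by (simp add: power2_eq_square mult_ac)
  also have "\<dots> \<le> a * (R\<^sup>2 * K) + R\<^sup>2 + b * (R\<^sup>2 * K) * (R\<^sup>2 * K) - R powr p * (2 * ln R)"
    using first total first0 a_pos b_pos K0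
    by (intro diff_right_mono add_mono mult_left_mono mult_mono order_refl) auto
  also have "\<dots> \<le> R ^ 4 * (a * K) + R ^ 4 + R ^ 4 * (b * K\<^sup>2) - R ^ 4 * (2 * ln R)"
  proof -
    have "R\<^sup>2 \<le> R ^ 4" using R1 by (intro power_increasing) auto
    moreover from this have "R\<^sup>2 * (a * K) \<le> R ^ 4 * (a * K)"
      using K0 a_pos by (intro mult_right_mono) auto
    moreover have "R ^ 4 * (2 * ln R) \<le> R powr p * (2 * ln R)"
      using p4 lnR by (intro mult_right_mono) auto
    moreover have "b * (R\<^sup>2 * K) * (R\<^sup>2 * K) = R ^ 4 * (b * K\<^sup>2)" by algebra
    moreover have "a * (R\<^sup>2 * K) = R\<^sup>2 * (a * K)" by simp
    ultimately show ?thesis by linarith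
  qed
  also have "\<dots> = - (R ^ 4 * ln R)" unfolding lnR(1) by algebra
  also have "\<dots> < 0" using R1 lnR by simp
  finally have neg: "J' (\<lambda>x. R * P x + t * Q x) P < 0"
    using R1 by (simp add: energy_deriv_scale mult_less_0_iff)
  have "((\<lambda>\<tau>. J (\<lambda>x. R * P x + t * Q x + \<tau> * P x)) has_real_derivative J' (\<lambda>x. R * P x + t * Q x) P) (at 0)"
    using has_derivative_energy[of "\<lambda>x. R * P x + t * Q x" P 0] by simp
  from DERIV_neg_dec_left[OF this neg] obtain \<delta> where "\<delta> > 0"
    and \<delta>: "\<And>h. 0 < h \<Longrightarrow> h < \<delta> \<Longrightarrow>
      J (\<lambda>x. R * P x + t * Q x) < J (\<lambda>x. R * P x + t * Q x + (- h) * P x)"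
    by auto
  \<comment> \<open>The bound by R keeps R - h inside the interval; \<delta> / 2 keeps h strictly
    below \<delta>.\<close>
  define h where "h = min (\<delta> / 2) R"
  have "0 < h" "h < \<delta>" "h \<le> R" using \<open>\<delta> > 0\<close> R1 by (auto simp: h_def)
  then show ?thesis using \<delta>[of h] by (intro bexI[of _ "R - h"]) (auto simp: algebra_simps)
qed

text \<open>Two points carry a bump of each sign. On the square with corners (0, 0) and (R, R) the
  energy rises when leaving an axis and rises again when moving inward from a far edge, so no
  maximum lies on the boundary.\<close>

lemma nodal_Nehari_nonempty:
  assumes "y \<in> \<Omega>" "z \<in> \<Omega>" "y \<noteq> z"
  shows "nodal_Nehari a b p \<Omega> \<noteq> {}"
proof -
  \<comment> \<open>The primed pair is the pair of negatives in exchanged roles. As the energy is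
    even, the estimates in s then also serve for t, with the same K and R.\<close>
  define P Q P' Q' :: "lattice \<Rightarrow> real" where "P = (\<lambda>x. if x = y then 1 else 0)"
    and "Q = (\<lambda>x. if x = z then - 1 else 0)" and "P' = (\<lambda>x. if x = z then 1 else 0)"
    and "Q' = (\<lambda>x. if x = y then - 1 else 0)"
  have ss: "sign_split P Q" "sign_split P' Q'"
    using assms by (auto simp: sign_split_def P_def Q_def P'_def Q'_def)
  have supp: "P \<in> supp_fun" "Q \<in> supp_fun" "P' \<in> supp_fun"
    using assms by (auto simp: supp_fun_def P_def Q_def P'_def)
  have nz: "P \<noteq> (\<lambda>x. 0)" "Q \<noteq> (\<lambda>x. 0)" "P' \<noteq> (\<lambda>x. 0)"
    by (auto simp: fun_eq_iff P_def Q_def P'_def)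
  have minus: "P = (\<lambda>x. (- 1) * Q' x)" "Q = (\<lambda>x. (- 1) * P' x)"
    by (auto simp: P_def Q_def P'_def Q'_def)
  have swap: "J (\<lambda>x. s * P x + t * Q x) = J (\<lambda>x. t * P' x + s * Q' x)" for s t
    using energy_minus[of "\<lambda>x. t * P' x + s * Q' x"] by (simp add: minus algebra_simps)
  define K where "K = dirichlet P P + dirichlet Q Q + 2 * dirichlet P Q"
  have K': "K = dirichlet P' P' + dirichlet Q' Q' + 2 * dirichlet P' Q'"
    unfolding K_def minus dirichlet_scale by (simp add: dirichlet_commute[of Q' P'])
  define R where "R = exp (a * K + 1 + b * K\<^sup>2)"
  have "R > 1"
  proof -
    have "K \<ge> 0" using dirichlet_nonneg dirichlet_sign_split_nonneg[OF ss(1)] by (simp add: K_def)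
    then have "a * K + 1 + b * K\<^sup>2 > 0" using a_pos b_pos by (intro add_nonneg_pos add_pos_nonneg) auto
    then show ?thesis by (simp add: R_def)
  qed
  have "\<exists>s\<in>{0..R}. \<exists>t\<in>{0..R}. (\<lambda>x. s * P x + t * Q x) \<in> nodal_Nehari a b p \<Omega>"
  proof (rule nodal_Nehari_of_fiber_max[OF ss(1) supp(1,2) nz(1,2)])
    fix s t assume st: "s \<in> {0..R}" "t \<in> {0..R}" "s = 0 \<or> s = R \<or> t = 0 \<or> t = R"
    from st(3) show "\<exists>s'\<in>{0..R}. \<exists>t'\<in>{0..R}. J (\<lambda>x. s * P x + t * Q x) < J (\<lambda>x. s' * P x + t' * Q x)"
    proof (elim disjE)
      assume "s = 0"
      then show ?thesis
        using energy_increases_from_axis[OF ss(1) supp(1) nz(1), of t] st \<open>R > 1\<close>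
        by (intro bexI[of _ 1] bexI[of _ t]) (auto simp: P_def)
    next
      assume "t = 0"
      then show ?thesis
        unfolding swap using energy_increases_from_axis[OF ss(2) supp(3) nz(3), of s] st \<open>R > 1\<close>
        by (intro bexI[of _ s] bexI[of _ 1]) (auto simp: P'_def)
    next
      assume "s = R"
      then obtain s' where "s' \<in> {0..R}" "J (\<lambda>x. s * P x + t * Q x) < J (\<lambda>x. s' * P x + t * Q x)"
        using energy_decreases_at_large_bump[OF ss(1) P_def assms(1) K_def R_def, of t] st by auto
      then show ?thesis using st(2) by blast
    next
      assume "t = R"
      then obtain t' where "t' \<in> {0..R}" "J (\<lambda>x. s * P x + t * Q x) < J (\<lambda>x. s * P x + t' * Q x)"
        unfolding swap
        using energy_decreases_at_large_bump[OF ss(2) P'_def assms(2) K' R_def, of s] st by auto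
      then show ?thesis using st(1) by blast
    qed
  qed (use \<open>R > 1\<close> in auto)
  then show ?thesis by auto
qed

section \<open>Minimisation over the nodal Nehari set\<close>

text \<open>If one part stayed within modulus 1, its logarithmic sum would be nonpositive while its
  mass is positive, so the derivative in its direction could not vanish. Hence neither sign can be
  lost in a limit.\<close>

lemma nodal_Nehari_large_values:
  assumes "u \<in> nodal_Nehari a b p \<Omega>"
  shows "\<exists>x\<in>\<Omega>. u x \<ge> 1" "\<exists>x\<in>\<Omega>. u x \<le> - 1"
proof -
  define P Q where "P = pos_part u" and "Q = neg_part u"
  have ss: "sign_split P Q" by (simp add: P_def Q_def sign_split_parts)
  have u: "u = (\<lambda>x. P x + Q x)" by (simp add: P_def Q_def parts_sum)
  have PQ: "P \<in> supp_fun" "Q \<in> supp_fun" "P \<noteq> (\<lambda>x. 0)" "Q \<noteq> (\<lambda>x. 0)"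
    "J' (\<lambda>x. P x + Q x) P = 0" "J' (\<lambda>x. P x + Q x) Q = 0"
    using assms supp_fun_parts[of u] by (auto simp: nodal_Nehari_iff P_def Q_def parts_sum)
  have nn: "dirichlet P P \<ge> 0" "dirichlet Q Q \<ge> 0" "dirichlet P Q \<ge> 0"
    using dirichlet_nonneg dirichlet_sign_split_nonneg ss by auto
  have pos: "(\<Sum>x\<in>\<Omega>. (P x)\<^sup>2) > 0" "(\<Sum>x\<in>\<Omega>. (Q x)\<^sup>2) > 0" using sum_square_pos PQ by auto
  have small: "(\<Sum>x\<in>\<Omega>. \<bar>v x\<bar> powr p * ln ((v x)\<^sup>2)) \<le> 0" if "\<And>x. x \<in> \<Omega> \<Longrightarrow> \<bar>v x\<bar> \<le> 1" for v
    using that by (intro sum_nonpos) (simp add: nonlin_mult_self_nonpos flip: nonlin_mult_self)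
  have terms: "a * (dirichlet P P + dirichlet P Q) \<ge> 0" "a * (dirichlet Q Q + dirichlet P Q) \<ge> 0"
    "b * (dirichlet P P + dirichlet Q Q + 2 * dirichlet P Q) * (dirichlet P P + dirichlet P Q) \<ge> 0"
    "b * (dirichlet P P + dirichlet Q Q + 2 * dirichlet P Q) * (dirichlet Q Q + dirichlet P Q) \<ge> 0"
    using nn a_pos b_pos by auto
  show "\<exists>x\<in>\<Omega>. u x \<ge> 1"
  proof (rule ccontr)
    assume "\<not> (\<exists>x\<in>\<Omega>. u x \<ge> 1)"
    then have "\<bar>P x\<bar> \<le> 1" if "x \<in> \<Omega>" for x using that by (force simp: P_def pos_part_def)
    from small[of P, OF this] show False
      using energy_deriv_fiber(1)[OF ss] PQ(5) terms pos by linarith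
  qed
  show "\<exists>x\<in>\<Omega>. u x \<le> - 1"
  proof (rule ccontr)
    assume "\<not> (\<exists>x\<in>\<Omega>. u x \<le> - 1)"
    then have "\<bar>Q x\<bar> \<le> 1" if "x \<in> \<Omega>" for x using that by (force simp: Q_def neg_part_def)
    from small[of Q, OF this] show False
      using energy_deriv_fiber(2)[OF ss] PQ(6) terms pos by linarith
  qed
qed

lemma energy_deriv_self_eq:
  "J' u u = a * dirichlet u u + (\<Sum>x\<in>\<Omega>. (u x)\<^sup>2) + b * (dirichlet u u)\<^sup>2
    - (\<Sum>x\<in>\<Omega>. \<bar>u x\<bar> powr p * ln ((u x)\<^sup>2))"
  by (simp add: energy_deriv_eq nonlin_mult_self power2_eq_square)

text \<open>The Nehari identity expresses H by the quadratic and quartic terms. Since 1/p \<le> 1/4,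
  the part subtracted is at most b D^2 / 4 plus half of the quadratic energy, which leaves at least
  L / 4.\<close>

lemma energy_coercive:
  assumes "J' u u = 0"
  shows "(\<Sum>x\<in>\<Omega>. (u x)\<^sup>2) \<le> 4 * J u"
proof -
  define D L N H where "D = dirichlet u u" and "L = (\<Sum>x\<in>\<Omega>. (u x)\<^sup>2)"
    and "N = (\<Sum>x\<in>\<Omega>. \<bar>u x\<bar> powr p)" and "H = (\<Sum>x\<in>\<Omega>. \<bar>u x\<bar> powr p * ln ((u x)\<^sup>2))"
  have nn: "D \<ge> 0" "L \<ge> 0" "N \<ge> 0" by (auto simp: D_def L_def N_def dirichlet_nonneg sum_nonneg)
  have "(\<Sum>x\<in>\<Omega>. potential p (u x)) = 2 / p\<^sup>2 * N - 1 / p * H"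
    by (simp only: potential_def sum_subtractf sum_distrib_left N_def H_def)
  then have J: "J u = 1/2 * (a * D + L) + b/4 * D\<^sup>2 + (2 / p\<^sup>2 * N - 1 / p * H)"
    by (simp add: energy_eq D_def L_def)
  have H: "H = a * D + L + b * D\<^sup>2"
    using assms by (simp add: energy_deriv_self_eq D_def L_def H_def)
  have "1 / p \<le> 1 / 4" using p_gt by (simp add: field_simps)
  then have "1 / p * H \<le> 1 / 4 * H"
    by (rule mult_right_mono) (use nn a_pos b_pos H in auto)
  moreover have "2 / p\<^sup>2 * N \<ge> 0" "a * D \<ge> 0" using nn a_pos by auto
  ultimately show ?thesis unfolding J using H unfolding L_def[symmetric] by argo
qed

text \<open>Direct method: the functions of energy at most J w lie in a compact box, and the nodal
  Nehari set is cut out there by closed conditions.\<close>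

lemma ex_nodal_minimizer:
  assumes "nodal_Nehari a b p \<Omega> \<noteq> {}"
  shows "\<exists>u\<in>nodal_Nehari a b p \<Omega>. \<forall>v\<in>nodal_Nehari a b p \<Omega>. J u \<le> J v"
proof -
  obtain w where w: "w \<in> nodal_Nehari a b p \<Omega>" using assms by auto
  \<comment> \<open>From u(x)^2 \<le> 4 J w and 2 \<bar>u(x)\<bar> \<le> u(x)^2 + 1 one gets
    \<bar>u(x)\<bar> \<le> B without a square root.\<close>
  define B where "B = 4 * J w + 1"
  \<comment> \<open>A product of intervals over \<Omega> and of {0} elsewhere: compact in the
    product topology although the lattice is infinite.\<close>
  define K where "K = PiE UNIV (\<lambda>x. if x \<in> \<Omega> then {- B..B} else {0::real})"
  have "compactin (product_topology (\<lambda>_. euclidean) UNIV) K"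
    unfolding K_def compactin_PiE by auto
  then have "compact K" by (simp add: euclidean_product_topology)
  have bounded: "u \<in> K" if u: "u \<in> nodal_Nehari a b p \<Omega>" "J u \<le> J w" for u
  proof -
    have "u \<in> supp_fun" "J' u u = 0" using u(1) by (auto simp: nodal_Nehari_iff energy_deriv_self)
    have "- B \<le> u x \<and> u x \<le> B" if "x \<in> \<Omega>" for x
    proof -
      have "(u x)\<^sup>2 \<le> (\<Sum>x\<in>\<Omega>. (u x)\<^sup>2)" using that finite_dom by (intro member_le_sum) auto
      also have "\<dots> \<le> 4 * J w" using energy_coercive[OF \<open>J' u u = 0\<close>] u(2) by simp
      finally have "\<bar>u x\<bar>\<^sup>2 \<le> 4 * J w" by simp
      moreover have "2 * \<bar>u x\<bar> \<le> \<bar>u x\<bar>\<^sup>2 + 1"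
        using zero_le_power2[of "\<bar>u x\<bar> - 1"] by (simp add: power2_diff)
      moreover have "\<bar>u x\<bar> \<ge> 0" by simp
      ultimately show ?thesis unfolding B_def by linarith
    qed
    then show ?thesis using \<open>u \<in> supp_fun\<close> by (auto simp: K_def supp_fun_def)
  qed
  \<comment> \<open>The open conditions that both parts are nonzero are replaced by closed ones: a
    value at least 1 and a value at most -1.\<close>
  define C where "C = {u. J' u (pos_part u) = 0} \<inter> {u. J' u (neg_part u) = 0}
    \<inter> (\<Union>x\<in>\<Omega>. {u. 1 \<le> u x}) \<inter> (\<Union>x\<in>\<Omega>. {u. u x \<le> - 1})"
  have coord: "continuous_on UNIV (\<lambda>u::lattice \<Rightarrow> real. u x)" for x by simp
  have "closed C"
    unfolding C_def pos_part_def [abs_def] neg_part_def [abs_def] using finite_dom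
    by (intro closed_Int closed_UN closed_Collect_eq closed_Collect_le continuous_on_energy_deriv
        continuous_on_max continuous_on_min continuous_on_const coord ballI)
  have C_nodal: "u \<in> nodal_Nehari a b p \<Omega>" if u: "u \<in> K \<inter> C" for u
  proof -
    have "u \<in> supp_fun" using u by (auto simp: K_def supp_fun_def PiE_def Pi_def split: if_splits)
    moreover obtain x y where "1 \<le> u x" "u y \<le> - 1" using u by (auto simp: C_def)
    then have "pos_part u x \<noteq> 0" "neg_part u y \<noteq> 0" by (auto simp: pos_part_def neg_part_def)
    then have "pos_part u \<noteq> (\<lambda>x. 0)" "neg_part u \<noteq> (\<lambda>x. 0)" by auto
    ultimately show ?thesis using u by (auto simp: nodal_Nehari_iff C_def)
  qed
  have nodal_C: "u \<in> C" if "u \<in> nodal_Nehari a b p \<Omega>" for u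
    using nodal_Nehari_large_values[OF that] that by (auto simp: C_def nodal_Nehari_iff)
  have "w \<in> K \<inter> C" using bounded nodal_C w by auto
  moreover have "compact (K \<inter> C)" using \<open>compact K\<close> \<open>closed C\<close> by (rule compact_Int_closed)
  moreover have "continuous_on (K \<inter> C) J"
    by (intro continuous_on_energy continuous_on_subset[OF coord]) auto
  ultimately obtain u where u: "u \<in> K \<inter> C" "\<And>v. v \<in> K \<inter> C \<Longrightarrow> J u \<le> J v"
    using continuous_attains_inf[of "K \<inter> C" J] by auto
  have "J u \<le> J v" if "v \<in> nodal_Nehari a b p \<Omega>" for v
  proof (cases "J v \<le> J w")
    case True
    then show ?thesis using bounded nodal_C u(2) that by auto
  next
    case False
    then show ?thesis using u(2)[OF \<open>w \<in> K \<inter> C\<close>] by simp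
  qed
  then show ?thesis using C_nodal u(1) by blast
qed

section \<open>Minimisers are critical points\<close>

text \<open>Where u is nonzero a small perturbation keeps its sign and belongs to the part already
  present; where u vanishes, the sign of \<phi> decides. As the support is finite, one threshold for
  \<epsilon> serves all points.\<close>

lemma eventually_sign_split_perturbed:
  assumes P: "P = pos_part u" and Q: "Q = neg_part u" and u: "P \<noteq> (\<lambda>x. 0)" "Q \<noteq> (\<lambda>x. 0)" "u \<in> supp_fun"
    and \<alpha>: "\<alpha> = (\<lambda>x. if u x > 0 then \<phi> x else if u x < 0 then 0 else max (\<phi> x) 0)"
    and \<beta>: "\<beta> = (\<lambda>x. if u x > 0 then 0 else if u x < 0 then \<phi> x else min (\<phi> x) 0)"
  shows "\<forall>\<^sub>F \<epsilon> in at_right (0::real). sign_split (\<lambda>x. P x + \<epsilon> * \<alpha> x) (\<lambda>x. Q x + \<epsilon> * \<beta> x)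
    \<and> (\<lambda>x. P x + \<epsilon> * \<alpha> x) \<noteq> (\<lambda>x. 0) \<and> (\<lambda>x. Q x + \<epsilon> * \<beta> x) \<noteq> (\<lambda>x. 0)"
proof -
  have "\<forall>\<^sub>F \<epsilon> in at_right (0::real). \<epsilon> * \<bar>\<phi> x\<bar> < \<bar>u x\<bar>" if "u x \<noteq> 0" for x
  proof (rule order_tendstoD)
    show "((\<lambda>\<epsilon>. \<epsilon> * \<bar>\<phi> x\<bar>) \<longlongrightarrow> 0 * \<bar>\<phi> x\<bar>) (at_right 0)" by (intro tendsto_intros)
  qed (use that in simp)
  moreover have "finite {x. u x \<noteq> 0}"
    using finite_subset[of "{x. u x \<noteq> 0}" \<Omega>] finite_dom u(3) by (auto simp: supp_fun_def)
  ultimately have "\<forall>\<^sub>F \<epsilon> in at_right (0::real). \<forall>x\<in>{x. u x \<noteq> 0}. \<epsilon> * \<bar>\<phi> x\<bar> < \<bar>u x\<bar>"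
    by (intro eventually_ball_finite) auto
  moreover have "\<forall>\<^sub>F \<epsilon> in at_right (0::real). \<epsilon> > 0" by (rule eventually_at_right_less)
  ultimately show ?thesis
  proof eventually_elim
    case (elim \<epsilon>)
    have small: "\<bar>\<epsilon> * \<phi> x\<bar> < \<bar>u x\<bar>" if "u x \<noteq> 0" for x
      using elim that by (simp add: abs_mult)
    have up: "P x + \<epsilon> * \<alpha> x > 0 \<and> Q x + \<epsilon> * \<beta> x = 0" if "u x > 0" for x
      using small[of x] that by (auto simp: P Q \<alpha> \<beta> pos_part_def neg_part_def)
    have down: "P x + \<epsilon> * \<alpha> x = 0 \<and> Q x + \<epsilon> * \<beta> x < 0" if "u x < 0" for x
      using small[of x] that by (auto simp: P Q \<alpha> \<beta> pos_part_def neg_part_def)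
    have flat: "P x + \<epsilon> * \<alpha> x \<ge> 0 \<and> Q x + \<epsilon> * \<beta> x \<le> 0 \<and> (P x + \<epsilon> * \<alpha> x) * (Q x + \<epsilon> * \<beta> x) = 0"
      if "u x = 0" for x
      using elim(2) that by (auto simp: P Q \<alpha> \<beta> pos_part_def neg_part_def max_def min_def mult_le_0_iff)
    have "sign_split (\<lambda>x. P x + \<epsilon> * \<alpha> x) (\<lambda>x. Q x + \<epsilon> * \<beta> x)"
      unfolding sign_split_def
    proof
      fix x
      show "P x + \<epsilon> * \<alpha> x \<ge> 0 \<and> Q x + \<epsilon> * \<beta> x \<le> 0 \<and> (P x + \<epsilon> * \<alpha> x) * (Q x + \<epsilon> * \<beta> x) = 0"
        using up[of x] down[of x] flat[of x] by (cases "u x" "0::real" rule: linorder_cases) auto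
    qed
    moreover obtain x y where "P x \<noteq> 0" "Q y \<noteq> 0" using u(1,2) by (meson ext)
    then have "u x > 0" "u y < 0" by (auto simp: P Q pos_part_def neg_part_def max_def min_def split: if_splits)
    then have "P x + \<epsilon> * \<alpha> x \<noteq> 0" "Q y + \<epsilon> * \<beta> y \<noteq> 0" using up[of x] down[of y] by auto
    then have "(\<lambda>x. P x + \<epsilon> * \<alpha> x) \<noteq> (\<lambda>x. 0)" "(\<lambda>x. Q x + \<epsilon> * \<beta> x) \<noteq> (\<lambda>x. 0)" by metis+
    ultimately show ?case by blast
  qed
qed

text \<open>For small \<open>\<epsilon> > 0\<close> the two parts of \<open>u + \<epsilon> \<phi>\<close> are affine in \<open>\<epsilon>\<close>.
  Were \<open>J' u \<phi> < 0\<close>, then near \<open>(1, 1)\<close> all energies on the fibre would drop, contradicting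
  minimality at the point where the perturbed fibre meets the nodal Nehari set.\<close>

lemma nodal_minimizer_deriv_nonneg:
  assumes u: "u \<in> nodal_Nehari a b p \<Omega>" and min: "\<And>v. v \<in> nodal_Nehari a b p \<Omega> \<Longrightarrow> J u \<le> J v"
    and \<phi>: "\<phi> \<in> supp_fun"
  shows "J' u \<phi> \<ge> 0"
proof (rule ccontr)
  assume "\<not> J' u \<phi> \<ge> 0"
  then have neg: "J' u \<phi> < 0" by simp
  define P Q where "P = pos_part u" and "Q = neg_part u"
  have ss: "sign_split P Q" by (simp add: P_def Q_def sign_split_parts)
  have u_eq: "(\<lambda>x. P x + Q x) = u" by (simp add: P_def Q_def parts_sum)
  have us: "u \<in> supp_fun" and PQ: "P \<in> supp_fun" "Q \<in> supp_fun" "P \<noteq> (\<lambda>x. 0)" "Q \<noteq> (\<lambda>x. 0)"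
    and crit: "J' (\<lambda>x. P x + Q x) P = 0" "J' (\<lambda>x. P x + Q x) Q = 0"
    using u supp_fun_parts[of u] by (auto simp: nodal_Nehari_iff P_def Q_def parts_sum)
  define \<alpha> \<beta> where "\<alpha> = (\<lambda>x. if u x > 0 then \<phi> x else if u x < 0 then 0 else max (\<phi> x) 0)"
    and "\<beta> = (\<lambda>x. if u x > 0 then 0 else if u x < 0 then \<phi> x else min (\<phi> x) 0)"
  have \<alpha>\<beta>: "(\<lambda>x. \<alpha> x + \<beta> x) = \<phi>" by (auto simp: \<alpha>_def \<beta>_def fun_eq_iff)
  have supp: "\<alpha> \<in> supp_fun" "\<beta> \<in> supp_fun"
    using us \<phi> by (auto simp: supp_fun_def \<alpha>_def \<beta>_def)
  define U where "U s t \<epsilon> = (\<lambda>x. s * P x + t * Q x + \<epsilon> * (s * \<alpha> x + t * \<beta> x))" for s t \<epsilon> :: real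
  have U_eq: "U s t \<epsilon> = (\<lambda>x. s * (P x + \<epsilon> * \<alpha> x) + t * (Q x + \<epsilon> * \<beta> x))" for s t \<epsilon>
    by (auto simp: U_def fun_eq_iff algebra_simps)
  have U0: "U s t 0 = (\<lambda>x. s * P x + t * Q x)" for s t by (simp add: U_def)
  have U1: "U 1 1 0 = u" using u_eq by (simp add: U_def)
  define G where "G z = J' (U (fst z) (fst (snd z)) (snd (snd z))) (\<lambda>x. fst z * \<alpha> x + fst (snd z) * \<beta> x)"
    for z :: "real \<times> real \<times> real"
  have "continuous_on UNIV G"
    unfolding G_def U_def by (intro continuous_on_energy_deriv continuous_intros)
  then have "open (G -` {..<0})" by (intro open_vimage) auto
  moreover have "(1, 1, 0) \<in> G -` {..<0}" using neg by (simp add: G_def U1 \<alpha>\<beta>)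
  ultimately obtain \<delta> where "\<delta> > 0" and \<delta>: "\<And>z. dist z (1, 1, 0) < \<delta> \<Longrightarrow> z \<in> G -` {..<0}"
    unfolding open_dist by blast
  \<comment> \<open>Three coordinates deviate by at most \<eta> each, so 3 \<eta> < \<delta>
    suffices; the cap 1/2 keeps the square in the positive quadrant.\<close>
  define \<eta> where "\<eta> = min (\<delta> / 4) (1 / 2)"
  have \<eta>: "0 < \<eta>" "\<eta> < 1" "3 * \<eta> < \<delta>" using \<open>\<delta> > 0\<close> by (auto simp: \<eta>_def)
  define l r where "l = 1 - \<eta>" and "r = 1 + \<eta>"
  have lr: "0 < l" "l < 1" "1 < r" using \<eta> by (auto simp: l_def r_def)
  have G_neg: "G (s, t, \<epsilon>) < 0" if "s \<in> {l..r}" "t \<in> {l..r}" "0 \<le> \<epsilon>" "\<epsilon> \<le> \<eta>" for s t \<epsilon>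
  proof -
    have "dist (s, t, \<epsilon>) (1, 1, 0) \<le> \<bar>s - 1\<bar> + \<bar>sqrt ((t - 1)\<^sup>2 + \<epsilon>\<^sup>2)\<bar>"
      using sqrt_sum_squares_le_sum_abs[of "s - 1" "sqrt ((t - 1)\<^sup>2 + \<epsilon>\<^sup>2)"]
      by (simp add: dist_Pair_Pair dist_real_def)
    also have "\<dots> \<le> \<bar>s - 1\<bar> + (\<bar>t - 1\<bar> + \<bar>\<epsilon>\<bar>)"
      using sqrt_sum_squares_le_sum_abs[of "t - 1" \<epsilon>] by simp
    also have "\<dots> \<le> 3 * \<eta>" using that by (auto simp: l_def r_def)
    also note \<eta>(3)
    finally show ?thesis using \<delta> by blast
  qed
  have drop: "J (U s t \<epsilon>) < J (U s t 0)" if st: "s \<in> {l..r}" "t \<in> {l..r}" and \<epsilon>: "0 < \<epsilon>" "\<epsilon> \<le> \<eta>" for s t \<epsilon>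
    unfolding U_def
  proof (rule DERIV_neg_imp_decreasing[OF \<epsilon>(1)])
    fix \<tau> assume "0 \<le> \<tau>" "\<tau> \<le> \<epsilon>"
    then have "G (s, t, \<tau>) < 0" using G_neg st \<epsilon> by simp
    then have "J' (\<lambda>x. s * P x + t * Q x + \<tau> * (s * \<alpha> x + t * \<beta> x)) (\<lambda>x. s * \<alpha> x + t * \<beta> x) < 0"
      by (simp add: G_def U_def)
    then show "\<exists>y. ((\<lambda>\<tau>. J (\<lambda>x. s * P x + t * Q x + \<tau> * (s * \<alpha> x + t * \<beta> x))) has_real_derivative y) (at \<tau>) \<and> y < 0"
      using has_derivative_energy[of "\<lambda>x. s * P x + t * Q x" "\<lambda>x. s * \<alpha> x + t * \<beta> x" \<tau>] by blast
  qed
  \<comment> \<open>The boundary of the square. It misses (1, 1), so strict concavity keeps the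
    maximum m of the unperturbed energy on it below J u.\<close>
  define Bd where "Bd = {l, r} \<times> {l..r} \<union> {l..r} \<times> {l, r}"
  have "compact Bd" unfolding Bd_def by (intro compact_Un compact_Times compact_Icc finite_imp_compact) auto
  moreover have "Bd \<noteq> {}" using lr by (auto simp: Bd_def)
  moreover have "continuous_on Bd (\<lambda>z. J (U (fst z) (snd z) 0))"
    unfolding U_def by (intro continuous_on_energy continuous_intros)
  ultimately obtain z where z: "z \<in> Bd" "\<And>z'. z' \<in> Bd \<Longrightarrow> J (U (fst z') (snd z') 0) \<le> J (U (fst z) (snd z) 0)"
    using continuous_attains_sup[of Bd "\<lambda>z. J (U (fst z) (snd z) 0)"] by auto
  define m where "m = J (U (fst z) (snd z) 0)"
  have "fst z > 0" "snd z > 0" "fst z \<noteq> 1 \<or> snd z \<noteq> 1" using z(1) lr by (auto simp: Bd_def)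
  then have "m < J u"
    using energy_fiber_less[OF ss _ _ crit PQ, of "fst z" "snd z"] by (simp add: m_def U0 u_eq)
  \<comment> \<open>For small \<epsilon> the perturbed centre still exceeds m, whereas the perturbed
    boundary lies below m by \<open>drop\<close>. Hence the perturbed maximum is interior.\<close>
  have "continuous_on UNIV (\<lambda>\<epsilon>. J (U 1 1 \<epsilon>))"
    unfolding U_def by (intro continuous_on_energy continuous_intros)
  then have "((\<lambda>\<epsilon>. J (U 1 1 \<epsilon>)) \<longlongrightarrow> J (U 1 1 0)) (at_right 0)"
    by (metis UNIV_I continuous_on_def tendsto_within_subset subset_UNIV)
  then have "\<forall>\<^sub>F \<epsilon> in at_right 0. m < J (U 1 1 \<epsilon>)"
    using \<open>m < J u\<close> U1 order_tendstoD(1) by metis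
  moreover have "\<forall>\<^sub>F \<epsilon> in at_right 0. \<epsilon> < \<eta>"
    using \<eta>(1) unfolding eventually_at_right_field by blast
  moreover note eventually_sign_split_perturbed[OF P_def Q_def PQ(3,4) us \<alpha>_def \<beta>_def]
  moreover have "\<forall>\<^sub>F \<epsilon> in at_right (0::real). \<epsilon> > 0" by (rule eventually_at_right_less)
  ultimately have "\<forall>\<^sub>F \<epsilon> in at_right 0. m < J (U 1 1 \<epsilon>) \<and> \<epsilon> < \<eta> \<and> \<epsilon> > 0
      \<and> sign_split (\<lambda>x. P x + \<epsilon> * \<alpha> x) (\<lambda>x. Q x + \<epsilon> * \<beta> x)
      \<and> (\<lambda>x. P x + \<epsilon> * \<alpha> x) \<noteq> (\<lambda>x. 0) \<and> (\<lambda>x. Q x + \<epsilon> * \<beta> x) \<noteq> (\<lambda>x. 0)"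
    by eventually_elim auto
  then obtain \<epsilon> where \<epsilon>: "m < J (U 1 1 \<epsilon>)" "\<epsilon> < \<eta>" "\<epsilon> > 0"
    "sign_split (\<lambda>x. P x + \<epsilon> * \<alpha> x) (\<lambda>x. Q x + \<epsilon> * \<beta> x)"
    "(\<lambda>x. P x + \<epsilon> * \<alpha> x) \<noteq> (\<lambda>x. 0)" "(\<lambda>x. Q x + \<epsilon> * \<beta> x) \<noteq> (\<lambda>x. 0)"
    using eventually_happens[of _ "at_right (0::real)"] by auto
  have "\<exists>s\<in>{l..r}. \<exists>t\<in>{l..r}. (\<lambda>x. s * (P x + \<epsilon> * \<alpha> x) + t * (Q x + \<epsilon> * \<beta> x)) \<in> nodal_Nehari a b p \<Omega>"
  proof (rule nodal_Nehari_of_fiber_max[OF \<epsilon>(4) _ _ \<epsilon>(5,6)])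
    show "(\<lambda>x. P x + \<epsilon> * \<alpha> x) \<in> supp_fun" "(\<lambda>x. Q x + \<epsilon> * \<beta> x) \<in> supp_fun"
      using supp PQ by (auto simp: supp_fun_def)
    fix s t assume st: "s \<in> {l..r}" "t \<in> {l..r}" "s = l \<or> s = r \<or> t = l \<or> t = r"
    then have "(s, t) \<in> Bd" by (auto simp: Bd_def)
    have "J (U s t \<epsilon>) < J (U s t 0)" using drop st \<epsilon> by simp
    also have "\<dots> \<le> m" using z(2)[OF \<open>(s, t) \<in> Bd\<close>] by (simp add: m_def)
    also note \<epsilon>(1)
    finally show "\<exists>s'\<in>{l..r}. \<exists>t'\<in>{l..r}. J (\<lambda>x. s * (P x + \<epsilon> * \<alpha> x) + t * (Q x + \<epsilon> * \<beta> x))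
        < J (\<lambda>x. s' * (P x + \<epsilon> * \<alpha> x) + t' * (Q x + \<epsilon> * \<beta> x))"
      unfolding U_eq using lr by (intro bexI[of _ 1]) auto
  qed (use lr in auto)
  then obtain s t where st: "s \<in> {l..r}" "t \<in> {l..r}" "U s t \<epsilon> \<in> nodal_Nehari a b p \<Omega>"
    unfolding U_eq by auto
  have "J u \<le> J (U s t \<epsilon>)" by (rule min[OF st(3)])
  also have "\<dots> < J (U s t 0)" using drop st \<epsilon> by simp
  also have "\<dots> \<le> J u"
    using energy_fiber_le[OF ss _ _ crit, of s t] st lr by (simp add: U0 u_eq)
  finally show False by simp
qed

text \<open>The derivative is linear in the test function, so the one-sided inequality for \<phi>
  and for its negative gives equality.\<close>

lemma nodal_minimizer_weak_solution:
  assumes "u \<in> nodal_Nehari a b p \<Omega>" "\<And>v. v \<in> nodal_Nehari a b p \<Omega> \<Longrightarrow> J u \<le> J v"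
  shows "weak_solution a b p \<Omega> u"
proof -
  have "J' u \<phi> = 0" if "\<phi> \<in> supp_fun" for \<phi>
  proof -
    have "(\<lambda>x. - 1 * \<phi> x) \<in> supp_fun" using that by (rule supp_fun_scale)
    then have "J' u (\<lambda>x. - 1 * \<phi> x) \<ge> 0" "J' u \<phi> \<ge> 0"
      using nodal_minimizer_deriv_nonneg assms that by blast+
    then show ?thesis unfolding energy_deriv_scale by simp
  qed
  then show ?thesis using assms(1) by (simp add: weak_solution_def nodal_Nehari_iff H01_eq)
qed

section \<open>Comparison with the ground level\<close>

text \<open>Along the ray the Nehari functional is negative at s = 1 and nonnegative once the values
  are scaled to modulus at most 1, where the logarithm has a favourable sign. The intermediate value
  theorem gives a zero between.\<close>

lemma ex_Nehari_scaling:
  assumes v: "v \<in> supp_fun" "v \<noteq> (\<lambda>x. 0)" and neg: "J' v v < 0"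
  shows "\<exists>s>0. (\<lambda>x. s * v x) \<in> Nehari a b p \<Omega>"
proof -
  \<comment> \<open>The sum dominates every value of v, and the summand 1 guarantees both a positive
    denominator and a scale of at most 1.\<close>
  define s\<^sub>0 where "s\<^sub>0 = 1 / (1 + (\<Sum>x\<in>\<Omega>. \<bar>v x\<bar>))"
  have "(\<Sum>x\<in>\<Omega>. \<bar>v x\<bar>) \<ge> 0" by (simp add: sum_nonneg)
  then have "1 + (\<Sum>x\<in>\<Omega>. \<bar>v x\<bar>) \<ge> 1" by simp
  then have s\<^sub>0: "0 < s\<^sub>0" "s\<^sub>0 \<le> 1" unfolding s\<^sub>0_def by (simp_all only: divide_le_eq_1 zero_less_divide_1_iff) auto
  have small: "\<bar>s\<^sub>0 * v x\<bar> \<le> 1" if "x \<in> \<Omega>" for x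
  proof -
    have "\<bar>v x\<bar> \<le> (\<Sum>x\<in>\<Omega>. \<bar>v x\<bar>)" using that finite_dom by (intro member_le_sum) auto
    then show ?thesis using s\<^sub>0 by (simp add: s\<^sub>0_def abs_mult divide_le_eq)
  qed
  have "(\<Sum>x\<in>\<Omega>. \<bar>s\<^sub>0 * v x\<bar> powr p * ln ((s\<^sub>0 * v x)\<^sup>2)) \<le> 0"
    unfolding nonlin_mult_self[symmetric] using small nonlin_mult_self_nonpos by (intro sum_nonpos) blast
  moreover have "(\<Sum>x\<in>\<Omega>. (s\<^sub>0 * v x)\<^sup>2) > 0"
    using sum_square_pos[OF supp_fun_scale[OF v(1)] scale_neq_zero[OF _ v(2)]] s\<^sub>0 by simp
  moreover have "a * dirichlet (\<lambda>x. s\<^sub>0 * v x) (\<lambda>x. s\<^sub>0 * v x) \<ge> 0" using a_pos dirichlet_nonneg by simp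
  moreover have "b * (dirichlet (\<lambda>x. s\<^sub>0 * v x) (\<lambda>x. s\<^sub>0 * v x))\<^sup>2 \<ge> 0" using b_pos by simp
  ultimately have "J' (\<lambda>x. s\<^sub>0 * v x) (\<lambda>x. s\<^sub>0 * v x) \<ge> 0" unfolding energy_deriv_self_eq by linarith
  moreover have "continuous_on {s\<^sub>0..1} (\<lambda>s. J' (\<lambda>x. s * v x) (\<lambda>x. s * v x))"
    by (intro continuous_on_energy_deriv continuous_intros)
  ultimately obtain s where s: "s\<^sub>0 \<le> s" "J' (\<lambda>x. s * v x) (\<lambda>x. s * v x) = 0"
    using IVT2'[of "\<lambda>s. J' (\<lambda>x. s * v x) (\<lambda>x. s * v x)" 1 0 s\<^sub>0] neg s\<^sub>0 by auto
  then have "s > 0" using s\<^sub>0 by simp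
  moreover have "(\<lambda>x. s * v x) \<in> Nehari a b p \<Omega>"
    using s(2) supp_fun_scale[OF v(1)] scale_neq_zero[of s v] v(2) \<open>s > 0\<close> by (simp add: Nehari_def H01_eq)
  ultimately show ?thesis by blast
qed

text \<open>Testing u with its own part P gives 0, and removing Q discards positive Kirchhoff terms,
  so \<open>J' P P < 0\<close>; likewise for Q. Both parts can thus be scaled into the Nehari set.
  Superadditivity is strict, and the scaled sum lies on the fibre of u, where u is maximal.\<close>

lemma ground_level_less_nodal:
  assumes "u \<in> nodal_Nehari a b p \<Omega>"
  shows "2 * ground_level a b p \<Omega> < ereal (J u)"
proof -
  define P Q where "P = pos_part u" and "Q = neg_part u"
  have ss: "sign_split P Q" by (simp add: P_def Q_def sign_split_parts)
  have u_eq: "(\<lambda>x. P x + Q x) = u" by (simp add: P_def Q_def parts_sum)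
  have PQ: "P \<in> supp_fun" "Q \<in> supp_fun" "P \<noteq> (\<lambda>x. 0)" "Q \<noteq> (\<lambda>x. 0)"
    and crit: "J' (\<lambda>x. P x + Q x) P = 0" "J' (\<lambda>x. P x + Q x) Q = 0"
    using assms supp_fun_parts[of u] by (auto simp: nodal_Nehari_iff P_def Q_def parts_sum)
  define d e c where "d = dirichlet P P" and "e = dirichlet Q Q" and "c = dirichlet P Q"
  have nn: "d > 0" "e > 0" "c \<ge> 0"
    using dirichlet_pos PQ dirichlet_sign_split_nonneg ss by (auto simp: d_def e_def c_def)
  have "(d + e + 2 * c) * (d + c) > d\<^sup>2" "(d + e + 2 * c) * (e + c) > e\<^sup>2"
    unfolding power2_eq_square using nn by (auto intro!: mult_less_le_imp_less)
  then have "b * (d + e + 2 * c) * (d + c) > b * d\<^sup>2" "b * (d + e + 2 * c) * (e + c) > b * e\<^sup>2"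
    using b_pos by (auto simp: mult.assoc)
  moreover have "a * (d + c) \<ge> a * d" "a * (e + c) \<ge> a * e" using a_pos nn by auto
  ultimately have "J' P P < 0" "J' Q Q < 0"
    using crit unfolding energy_deriv_self_eq energy_deriv_fiber[OF ss]
    by (simp_all flip: d_def e_def c_def)
  then obtain s t where st: "s > 0" "t > 0" "(\<lambda>x. s * P x) \<in> Nehari a b p \<Omega>" "(\<lambda>x. t * Q x) \<in> Nehari a b p \<Omega>"
    using ex_Nehari_scaling PQ by meson
  have "ground_level a b p \<Omega> \<le> ereal (J (\<lambda>x. s * P x))" "ground_level a b p \<Omega> \<le> ereal (J (\<lambda>x. t * Q x))"
    unfolding ground_level_def using st by (auto intro: INF_lower)
  then have "ground_level a b p \<Omega> + ground_level a b p \<Omega> \<le> ereal (J (\<lambda>x. s * P x)) + ereal (J (\<lambda>x. t * Q x))"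
    by (rule add_mono)
  \<comment> \<open>The case split covers infinite values, since the level is an extended
    real.\<close>
  moreover have "2 * ground_level a b p \<Omega> = ground_level a b p \<Omega> + ground_level a b p \<Omega>"
    by (cases "ground_level a b p \<Omega>") auto
  moreover have "J (\<lambda>x. s * P x) + J (\<lambda>x. t * Q x) < J (\<lambda>x. s * P x + t * Q x)"
    using st PQ ss by (intro energy_superadditive sign_split_scale supp_fun_scale scale_neq_zero) auto
  moreover have "J (\<lambda>x. s * P x + t * Q x) \<le> J u"
    using energy_fiber_le[OF ss st(1,2) crit] by (simp add: u_eq)
  ultimately show ?thesis by (auto intro: le_less_trans)
qed

lemma ex_least_energy_nodal:
  assumes "y \<in> \<Omega>" "z \<in> \<Omega>" "y \<noteq> z"
  shows "\<exists>u. sign_changing_solution a b p \<Omega> u \<and> ereal (J u) = nodal_level a b p \<Omega>"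
    and "2 * ground_level a b p \<Omega> < nodal_level a b p \<Omega>"
proof -
  obtain u where u: "u \<in> nodal_Nehari a b p \<Omega>" "\<And>v. v \<in> nodal_Nehari a b p \<Omega> \<Longrightarrow> J u \<le> J v"
    using ex_nodal_minimizer[OF nodal_Nehari_nonempty[OF assms]] by blast
  have "sign_changing_solution a b p \<Omega> u"
    using nodal_minimizer_weak_solution[OF u] u(1) by (simp add: sign_changing_solution_def nodal_Nehari_iff)
  moreover have level: "nodal_level a b p \<Omega> = ereal (J u)"
    unfolding nodal_level_def by (rule antisym) (auto intro!: INF_lower INF_greatest u)
  ultimately show "\<exists>u. sign_changing_solution a b p \<Omega> u \<and> ereal (J u) = nodal_level a b p \<Omega>" by auto
  show "2 * ground_level a b p \<Omega> < nodal_level a b p \<Omega>"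
    unfolding level by (rule ground_level_less_nodal[OF u(1)])
qed

end

section \<open>From the conditions on h to a finite domain\<close>

text \<open>The zero set lies in the sublevel set {h < M} as M > 0, and a set of finite counting
  measure is finite.\<close>

lemma finite_of_cond_h2:
  assumes "cond_h2 h"
  shows "finite {x. h x = 0}"
proof -
  obtain M where "M > 0" "emeasure (count_space UNIV) {x. h x < M} < \<infinity>"
    using assms by (auto simp: cond_h2_def)
  then have "finite {x. h x < M}"
    by (metis emeasure_count_space_infinite subset_UNIV less_irrefl infinity_ennreal_def)
  then show ?thesis by (rule finite_subset[rotated]) (use \<open>M > 0\<close> in auto)
qed

theorem theorem1p2:
  fixes a b p :: real and h :: "lattice \<Rightarrow> real" and \<Omega> :: "lattice set"
  assumes "a > 0" and "b > 0" and "p > 6"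
    and "cond_h1 h" and "cond_h2 h"
    and "\<Omega> = {x. h x = 0}"
    and "\<exists>x\<in>\<Omega>. \<exists>y\<in>\<Omega>. x \<noteq> y"
  shows "(\<exists>u\<^sub>0. sign_changing_solution a b p \<Omega> u\<^sub>0 \<and>
              ereal (energy a b p \<Omega> u\<^sub>0) = nodal_level a b p \<Omega>) \<and>
         nodal_level a b p \<Omega> > 2 * ground_level a b p \<Omega>"
proof -
  interpret kirchhoff a b p \<Omega>
    using assms finite_of_cond_h2[of h] by unfold_locales auto
  obtain y z where "y \<in> \<Omega>" "z \<in> \<Omega>" "y \<noteq> z" using assms(7) by blast
  then show ?thesis using ex_least_energy_nodal by blast
qed

end
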